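(* Let $\mathcal{M}$ be a von Neumann algebra with a faithful normal tracial state $\tau$. Then $d_C(P,Q)=d_{MT}(P,Q)$ for all $*$-subalgebras $P,Q$ of $\mathcal{M}$ containing $1_{\mathcal{M}}$.
   Context: $\|x\|_\tau=\tau(x^*x)^{1/2}$ for $x\in\mathcal{M}$. For a subalgebra $P$ of $\mathcal{M}$, $B_1(P)$ is its closed unit ball with respect to the operator norm. For subalgebras $P,Q$ of $\mathcal{M}$ and $\gamma>0$, write $P\subset_\gamma Q$ if for each $x\in B_1(P)$ there exists $y\in Q$ with $\|x-y\|_\tau\le\gamma$. The Christensen distance is $d_C(P,Q)=\inf\{\gamma>0: P\subset_\gamma Q\text{ and }Q\subset_\gamma P\}$. The Mashood-Taylor distance is the Hausdorff distance with respect to $\|\cdot\|_\tau$ between the operator-norm unit balls: $d_{MT}(P,Q)=\max\{\sup_{x\in B_1(P)}\inf_{y\in B_1(Q)}\|x-y\|_\tau,\ \sup_{y\in B_1(Q)}\inf_{x\in B_1(P)}\|x-y\|_\tau\}$. *)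

theory Defs
  imports "HOL-Analysis.Analysis"
begin

text \<open>
  Complex Hilbert spaces. The inner product is linear in its first argument; the last axiom
  contains its positive definiteness.
\<close>

class chilbert_space = banach +
  fixes scaleC :: "complex \<Rightarrow> 'a \<Rightarrow> 'a" (infixr "*\<^sub>C" 75)
    and cinner :: "'a \<Rightarrow> 'a \<Rightarrow> complex"
  assumes scaleR_scaleC: "r *\<^sub>R x = complex_of_real r *\<^sub>C x"
    and scaleC_add_right: "a *\<^sub>C (x + y) = a *\<^sub>C x + a *\<^sub>C y"
    and scaleC_add_left: "(a + b) *\<^sub>C x = a *\<^sub>C x + b *\<^sub>C x"
    and scaleC_scaleC: "a *\<^sub>C b *\<^sub>C x = (a * b) *\<^sub>C x"
    and cinner_commute: "cinner x y = cnj (cinner y x)"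
    and cinner_add_left: "cinner (x + y) z = cinner x z + cinner y z"
    and cinner_scaleC_left: "cinner (a *\<^sub>C x) y = a * cinner x y"
    and cinner_self: "cinner x x = complex_of_real ((norm x)\<^sup>2)"

instantiation complex :: chilbert_space
begin

definition scaleC_complex :: "complex \<Rightarrow> complex \<Rightarrow> complex"
  where "scaleC_complex a x = a * x"

definition cinner_complex :: "complex \<Rightarrow> complex \<Rightarrow> complex"
  where "cinner_complex x y = x * cnj y"

instance
  by standard
    (simp_all add: scaleC_complex_def cinner_complex_def algebra_simps scaleR_conv_of_real
      complex_mult_cnj cmod_power2)

end

lemma norm_scaleC: "norm (a *\<^sub>C x) = cmod a * norm (x :: 'h::chilbert_space)"
proof -
  have "cinner (a *\<^sub>C x) (a *\<^sub>C x) = a * cnj a * cinner x x"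
    unfolding cinner_scaleC_left by (subst cinner_commute) (simp add: cinner_scaleC_left cinner_self)
  then have "complex_of_real ((norm (a *\<^sub>C x))\<^sup>2) = complex_of_real ((cmod a * norm x)\<^sup>2)"
    unfolding cinner_self by (metis complex_norm_square of_real_mult of_real_power power_mult_distrib)
  then have "(norm (a *\<^sub>C x))\<^sup>2 = (cmod a * norm x)\<^sup>2"
    using of_real_eq_iff by blast
  then show ?thesis by simp
qed

lemma bounded_linear_scaleC: "bounded_linear (\<lambda>x :: 'h::chilbert_space. a *\<^sub>C x)"
proof (rule bounded_linear_intro)
  show "a *\<^sub>C (x + y) = a *\<^sub>C x + a *\<^sub>C y" for x y :: 'h
    by (rule scaleC_add_right)
  show "a *\<^sub>C r *\<^sub>R x = r *\<^sub>R a *\<^sub>C x" for r and x :: 'h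
    by (simp add: scaleR_scaleC scaleC_scaleC mult.commute)
  show "norm (a *\<^sub>C x) \<le> norm x * cmod a" for x :: 'h
    by (simp add: norm_scaleC)
qed

text \<open>
  The type of bounded real-linear operators carries the operator norm; the bounded operators
  on the complex Hilbert space are its complex-linear elements.
\<close>

definition bounded_operators :: "('h::chilbert_space \<Rightarrow>\<^sub>L 'h) set"
  where "bounded_operators = {T. \<forall>a x. blinfun_apply T (a *\<^sub>C x) = a *\<^sub>C T x}"

definition scaleC_op :: "complex \<Rightarrow> ('h::chilbert_space \<Rightarrow>\<^sub>L 'h) \<Rightarrow> ('h \<Rightarrow>\<^sub>L 'h)"
  where "scaleC_op a T = Blinfun (\<lambda>x. a *\<^sub>C T x)"

lemma scaleC_op_apply: "scaleC_op a T x = a *\<^sub>C T x"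
proof -
  have "bounded_linear (\<lambda>x. a *\<^sub>C T x)"
    by (rule bounded_linear_compose[OF bounded_linear_scaleC blinfun.bounded_linear_right])
  then show ?thesis
    by (simp add: scaleC_op_def bounded_linear_Blinfun_apply)
qed

definition cadjoint :: "('h::chilbert_space \<Rightarrow>\<^sub>L 'h) \<Rightarrow> ('h \<Rightarrow>\<^sub>L 'h)"
  where "cadjoint T = (THE S. \<forall>x y. cinner (blinfun_apply S x) y = cinner x (T y))"

lemma scaleC_one: "1 *\<^sub>C x = (x :: 'h::chilbert_space)"
  using scaleR_scaleC[of 1 x] by simp

lemma cinner_add_right: "cinner x (y + z) = cinner x y + cinner x (z :: 'h::chilbert_space)"
  by (simp add: cinner_commute[of x] cinner_add_left)

lemma cinner_scaleC_right: "cinner x (a *\<^sub>C y) = cnj a * cinner x (y :: 'h::chilbert_space)"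
  by (simp add: cinner_commute[of x] cinner_scaleC_left)

lemma cinner_diff_left: "cinner (x - y) z = cinner x z - cinner y (z :: 'h::chilbert_space)"
  by (metis add_diff_cancel cinner_add_left diff_add_cancel)

lemma cinner_diff_right: "cinner x (y - z) = cinner x y - cinner x (z :: 'h::chilbert_space)"
  by (metis add_diff_cancel cinner_add_right diff_add_cancel)

lemma cinner_zero_right: "cinner x (0 :: 'h::chilbert_space) = 0"
  using cinner_diff_right[of x 0 0] by simp

lemma cinner_eqI:
  fixes y z :: "'h::chilbert_space"
  assumes "\<And>x. cinner y x = cinner z x"
  shows "y = z"
proof -
  have "cinner (y - z) (y - z) = 0"
    using assms by (simp add: cinner_diff_left)
  then show ?thesis by (simp add: cinner_self)
qed

lemma norm_add_sq:
  "(norm (x + y))\<^sup>2 = (norm x)\<^sup>2 + (norm y)\<^sup>2 + 2 * Re (cinner x (y :: 'h::chilbert_space))"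
proof -
  have "cinner (x + y) (x + y) = cinner x x + cinner y y + (cinner x y + cnj (cinner x y))"
    by (simp add: cinner_add_left cinner_add_right cinner_commute[of y x])
  then have "Re (cinner (x + y) (x + y)) = Re (cinner x x + cinner y y + (cinner x y + cnj (cinner x y)))"
    by simp
  then show ?thesis by (simp add: cinner_self del: of_real_power)
qed

lemma parallelogram:
  fixes x y :: "'h::chilbert_space"
  shows "(norm (x - y))\<^sup>2 = 2 * (norm x)\<^sup>2 + 2 * (norm y)\<^sup>2 - (norm (x + y))\<^sup>2"
proof -
  have m: "cinner x (- y) = - cinner x y"
    using cinner_diff_right[of x 0 y] by (simp add: cinner_zero_right)
  show ?thesis
    using norm_add_sq[of x y] norm_add_sq[of x "- y"] by (simp add: m)
qed

lemma riesz:
  fixes f :: "'h::chilbert_space \<Rightarrow> complex"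
  assumes bl: "bounded_linear f" and hom: "\<And>a x. f (a *\<^sub>C x) = a * f x"
  shows "\<exists>z. \<forall>x. f x = cinner x z"
proof (cases "\<forall>x. f x = 0")
  case True
  then show ?thesis by (intro exI[of _ 0]) (simp add: cinner_zero_right)
next
  case False
  interpret f: bounded_linear f by (rule bl)
  from False obtain w where w: "f w \<noteq> 0" by blast
  define C where "C = {x. f x = 1}"
  define d where "d = Inf (norm ` C)"
  have ne: "C \<noteq> {}"
    using w hom[of "1 / f w" w] by (auto simp: C_def)
  have bdd: "bdd_below (norm ` C)" by (intro bdd_belowI[of _ 0]) auto
  have dle: "d \<le> norm x" if "x \<in> C" for x
    unfolding d_def using bdd that by (intro cInf_lower) auto
  have d0: "0 \<le> d" unfolding d_def using ne by (intro cInf_greatest) auto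
  have "\<exists>u\<in>C. norm u < d + 1 / Suc n" for n
  proof -
    have "Inf (norm ` C) < d + 1 / Suc n" unfolding d_def by simp
    then show ?thesis using ne cInf_lessD[of "norm ` C"] by blast
  qed
  then obtain u where u: "\<And>n. u n \<in> C" "\<And>n. norm (u n) < d + 1 / Suc n" by metis
  have key: "(norm (x - y))\<^sup>2 \<le> 8 * d * e + 4 * e\<^sup>2"
    if "x \<in> C" "y \<in> C" "norm x \<le> d + e" "norm y \<le> d + e" for x y e
  proof -
    have "(1/2) *\<^sub>R (x + y) \<in> C"
      using that by (simp add: C_def f.scaleR f.add scaleR_conv_of_real)
    from dle[OF this] have "2 * d \<le> norm (x + y)" by simp
    then have 1: "(2 * d)\<^sup>2 \<le> (norm (x + y))\<^sup>2" using d0 by (intro power_mono) auto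
    have 2: "(norm x)\<^sup>2 \<le> (d + e)\<^sup>2" "(norm y)\<^sup>2 \<le> (d + e)\<^sup>2"
      using that by (auto intro!: power_mono)
    show ?thesis using 1 2 unfolding parallelogram[of x y]
      by (simp add: power2_eq_square algebra_simps)
  qed
  have "Cauchy u"
  proof (rule metric_CauchyI)
    fix e :: real assume e: "0 < e"
    have "(\<lambda>n. 8 * d * (1 / real (Suc n)) + 4 * (1 / real (Suc n))\<^sup>2) \<longlonglongrightarrow> 8 * d * 0 + 4 * 0\<^sup>2"
      by (intro tendsto_intros LIMSEQ_Suc lim_1_over_n)
    then have "eventually (\<lambda>n. 8 * d * (1 / real (Suc n)) + 4 * (1 / real (Suc n))\<^sup>2 < e\<^sup>2) sequentially"
      using e by (auto dest: order_tendstoD(2)[where a = "e\<^sup>2"])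
    then obtain N where N: "8 * d * (1 / real (Suc N)) + 4 * (1 / real (Suc N))\<^sup>2 < e\<^sup>2"
      by (auto simp: eventually_sequentially)
    have small: "norm (u n) \<le> d + 1 / Suc N" if "n \<ge> N" for n
    proof -
      have "1 / real (Suc n) \<le> 1 / real (Suc N)" using that by (simp add: frac_le)
      then show ?thesis using u(2)[of n] by linarith
    qed
    show "\<exists>N. \<forall>m\<ge>N. \<forall>n\<ge>N. dist (u m) (u n) < e"
    proof (intro exI[of _ N] allI impI)
      fix m n assume "N \<le> m" "N \<le> n"
      then have "(norm (u m - u n))\<^sup>2 < e\<^sup>2"
        using key[OF u(1) u(1) small small, of m n] N by linarith
      then show "dist (u m) (u n) < e"
        using e by (simp add: dist_norm power2_less_imp_less)
    qed
  qed
  then obtain z where z: "u \<longlonglongrightarrow> z"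
    by (auto simp: Cauchy_convergent_iff convergent_def)
  have "(\<lambda>n. f (u n)) \<longlonglongrightarrow> f z" by (intro f.tendsto z)
  moreover have "f (u n) = 1" for n using u(1) by (simp add: C_def)
  ultimately have fz: "f z = 1" by (simp add: LIMSEQ_const_iff)
  have zd: "norm z \<le> d"
  proof (rule LIMSEQ_le)
    show "(\<lambda>n. norm (u n)) \<longlonglongrightarrow> norm z" by (intro tendsto_norm z)
    have "(\<lambda>n. d + 1 / real (Suc n)) \<longlonglongrightarrow> d + 0"
      by (intro tendsto_intros LIMSEQ_Suc lim_1_over_n)
    then show "(\<lambda>n. d + 1 / real (Suc n)) \<longlonglongrightarrow> d" by simp
    show "\<exists>N. \<forall>n\<ge>N. norm (u n) \<le> d + 1 / real (Suc n)"
      using u(2) less_imp_le by blast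
  qed
  have orth: "cinner v z = 0" if v: "f v = 0" for v
  proof (rule ccontr)
    assume nz: "cinner v z \<noteq> 0"
    then have v0: "norm v \<noteq> 0"
      using cinner_commute[of v z] by (auto simp: cinner_zero_right)
    define c where "c = - cnj (cinner v z) / complex_of_real ((norm v)\<^sup>2)"
    have "z + c *\<^sub>C v \<in> C" using fz v by (simp add: C_def f.add hom)
    from dle[OF this] have "(norm z)\<^sup>2 \<le> (norm (z + c *\<^sub>C v))\<^sup>2"
      using zd by (intro power_mono) auto
    also have "\<dots> = (norm z)\<^sup>2 + (cmod c * norm v)\<^sup>2 + 2 * Re (cnj c * cinner z v)"
      by (simp add: norm_add_sq norm_scaleC cinner_scaleC_right)
    finally have *: "0 \<le> (cmod c * norm v)\<^sup>2 + 2 * Re (cnj c * cinner z v)" by simp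
    have "cnj c * cinner z v = - (cinner v z * cnj (cinner v z)) / complex_of_real ((norm v)\<^sup>2)"
      unfolding c_def by (subst cinner_commute[of z v]) simp
    also have "\<dots> = complex_of_real (- (cmod (cinner v z))\<^sup>2 / (norm v)\<^sup>2)"
      by (simp add: complex_norm_square[symmetric] del: of_real_power)
    finally have 1: "Re (cnj c * cinner z v) = - (cmod (cinner v z))\<^sup>2 / (norm v)\<^sup>2"
      using Re_complex_of_real by metis
    have 2: "(cmod c * norm v)\<^sup>2 = (cmod (cinner v z))\<^sup>2 / (norm v)\<^sup>2"
      using v0 by (simp add: c_def norm_divide norm_mult power2_eq_square)
    have "0 < (cmod (cinner v z))\<^sup>2 / (norm v)\<^sup>2" using nz v0 by simp
    then show False using * unfolding 1 2 by linarith
  qed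
  have z0: "norm z \<noteq> 0" using fz f.zero by auto
  define k where "k = complex_of_real (1 / (norm z)\<^sup>2)"
  show ?thesis
  proof (intro exI[of _ "k *\<^sub>C z"] allI)
    fix x
    have "f (x - f x *\<^sub>C z) = 0" by (simp add: f.diff hom fz)
    from orth[OF this] have "cinner x z = f x * cinner z z"
      by (simp add: cinner_diff_left cinner_scaleC_left)
    then show "f x = cinner x (k *\<^sub>C z)"
      using z0 by (simp add: cinner_scaleC_right k_def cinner_self)
  qed
qed

lemma cauchy_schwarz: "cmod (cinner x y) \<le> norm x * norm (y :: 'h::chilbert_space)"
proof (cases "y = 0")
  case True
  then show ?thesis by (simp add: cinner_zero_right)
next
  case False
  define c where "c = - cinner x y / complex_of_real ((norm y)\<^sup>2)"
  have "0 \<le> (norm (x + c *\<^sub>C y))\<^sup>2" by simp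
  also have "\<dots> = (norm x)\<^sup>2 + (cmod c * norm y)\<^sup>2 + 2 * Re (cnj c * cinner x y)"
    by (simp add: norm_add_sq norm_scaleC cinner_scaleC_right)
  also have "cnj c * cinner x y = complex_of_real (- (cmod (cinner x y))\<^sup>2 / (norm y)\<^sup>2)"
    using complex_norm_square[of "cinner x y"] by (simp add: c_def mult.commute)
  also have "(cmod c * norm y)\<^sup>2 = (cmod (cinner x y))\<^sup>2 / (norm y)\<^sup>2"
    using False by (simp add: c_def norm_divide norm_mult power2_eq_square)
  finally have "(cmod (cinner x y))\<^sup>2 / (norm y)\<^sup>2 \<le> (norm x)\<^sup>2" by simp
  then have "(cmod (cinner x y))\<^sup>2 \<le> (norm x * norm y)\<^sup>2"
    using False by (simp add: divide_simps power_mult_distrib)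
  then show ?thesis by (rule power2_le_imp_le) simp
qed

lemma cadjoint_unique:
  assumes "\<And>x y. cinner (blinfun_apply S x) y = cinner x (blinfun_apply T y)"
  shows "cadjoint T = S"
  unfolding cadjoint_def
proof (rule the_equality)
  fix R assume R: "\<forall>x y. cinner (blinfun_apply R x) y = cinner x (blinfun_apply T y)"
  show "R = S"
    by (rule blinfun_eqI, rule cinner_eqI) (simp add: assms R)
qed (simp add: assms)

lemma cinner_cadjoint:
  fixes T :: "'h::chilbert_space \<Rightarrow>\<^sub>L 'h"
  assumes "T \<in> bounded_operators"
  shows "cinner (cadjoint T x) y = cinner x (T y)"
proof -
  have "\<exists>z. \<forall>y. cinner (T y) x = cinner y z" for x
  proof (rule riesz)
    show "bounded_linear (\<lambda>y. cinner (T y) x)"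
    proof (rule bounded_linear_intro)
      show "cinner (T (y + y')) x = cinner (T y) x + cinner (T y') x" for y y'
        by (simp add: blinfun.add_right cinner_add_left)
      show "cinner (T (r *\<^sub>R y)) x = r *\<^sub>R cinner (T y) x" for r y
        by (simp add: blinfun.scaleR_right scaleR_scaleC[of r "T y"] cinner_scaleC_left
            scaleR_conv_of_real)
      have "cmod (cinner (T y) x) \<le> (norm T * norm y) * norm x" for y
        by (rule order_trans[OF cauchy_schwarz]) (intro mult_right_mono norm_blinfun norm_ge_zero)
      then show "cmod (cinner (T y) x) \<le> norm y * (norm T * norm x)" for y
        by (metis mult.assoc mult.commute)
    qed
    show "cinner (T (a *\<^sub>C y)) x = a * cinner (T y) x" for a y
      using assms by (simp add: bounded_operators_def cinner_scaleC_left)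
  qed
  then obtain g where "\<And>x y. cinner (T y) x = cinner y (g x)" by metis
  then have g: "cinner (g x) y = cinner x (T y)" for x y
    by (metis cinner_commute)
  have "bounded_linear g"
  proof (rule bounded_linear_intro)
    show "g (x + x') = g x + g x'" for x x'
      by (rule cinner_eqI) (simp add: g cinner_add_left)
    show "g (r *\<^sub>R x) = r *\<^sub>R g x" for r x
      by (rule cinner_eqI) (simp add: g scaleR_scaleC cinner_scaleC_left)
    show "norm (g x) \<le> norm x * norm T" for x
    proof (cases "norm (g x) = 0")
      case False
      have "(norm (g x))\<^sup>2 = cmod (cinner (g x) (g x))"
        by (simp add: cinner_self norm_power)
      also have "\<dots> \<le> norm x * norm (T (g x))"
        unfolding g by (rule cauchy_schwarz)
      also have "\<dots> \<le> norm x * (norm T * norm (g x))"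
        by (intro mult_left_mono norm_blinfun norm_ge_zero)
      finally have "norm (g x) * norm (g x) \<le> (norm x * norm T) * norm (g x)"
        by (simp add: power2_eq_square mult_ac)
      then show ?thesis by (rule mult_right_le_imp_le) (use False in simp)
    qed simp
  qed
  then have "cadjoint T = Blinfun g"
    by (intro cadjoint_unique) (simp add: bounded_linear_Blinfun_apply g)
  with \<open>bounded_linear g\<close> show ?thesis
    by (simp add: bounded_linear_Blinfun_apply g)
qed

definition star_subalgebra :: "('h::chilbert_space \<Rightarrow>\<^sub>L 'h) set \<Rightarrow> bool"
  where "star_subalgebra A \<longleftrightarrow>
    A \<subseteq> bounded_operators \<and> 0 \<in> A \<and>
    (\<forall>x\<in>A. \<forall>y\<in>A. x + y \<in> A) \<and>
    (\<forall>a. \<forall>x\<in>A. scaleC_op a x \<in> A) \<and>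
    (\<forall>x\<in>A. \<forall>y\<in>A. x o\<^sub>L y \<in> A) \<and>
    (\<forall>x\<in>A. cadjoint x \<in> A)"

definition commutant :: "('h::chilbert_space \<Rightarrow>\<^sub>L 'h) set \<Rightarrow> ('h \<Rightarrow>\<^sub>L 'h) set"
  where "commutant A = {x \<in> bounded_operators. \<forall>y\<in>A. x o\<^sub>L y = y o\<^sub>L x}"

definition von_neumann_algebra :: "('h::chilbert_space \<Rightarrow>\<^sub>L 'h) set \<Rightarrow> bool"
  where "von_neumann_algebra M \<longleftrightarrow> star_subalgebra M \<and> commutant (commutant M) = M"

definition positive_op :: "('h::chilbert_space \<Rightarrow>\<^sub>L 'h) \<Rightarrow> bool"
  where "positive_op T \<longleftrightarrow> T \<in> bounded_operators \<and> (\<forall>\<xi>. cinner (T \<xi>) \<xi> \<in> \<real>\<^sub>\<ge>\<^sub>0)"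

definition state_on ::
    "('h::chilbert_space \<Rightarrow>\<^sub>L 'h) set \<Rightarrow> (('h \<Rightarrow>\<^sub>L 'h) \<Rightarrow> complex) \<Rightarrow> bool"
  where "state_on M \<tau> \<longleftrightarrow>
    (\<forall>x\<in>M. \<forall>y\<in>M. \<tau> (x + y) = \<tau> x + \<tau> y) \<and>
    (\<forall>a. \<forall>x\<in>M. \<tau> (scaleC_op a x) = a * \<tau> x) \<and>
    (\<forall>x\<in>M. \<tau> (cadjoint x o\<^sub>L x) \<in> \<real>\<^sub>\<ge>\<^sub>0) \<and>
    \<tau> id_blinfun = 1"

definition tracial_on ::
    "('h::chilbert_space \<Rightarrow>\<^sub>L 'h) set \<Rightarrow> (('h \<Rightarrow>\<^sub>L 'h) \<Rightarrow> complex) \<Rightarrow> bool"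
  where "tracial_on M \<tau> \<longleftrightarrow> (\<forall>x\<in>M. \<forall>y\<in>M. \<tau> (x o\<^sub>L y) = \<tau> (y o\<^sub>L x))"

definition faithful_on ::
    "('h::chilbert_space \<Rightarrow>\<^sub>L 'h) set \<Rightarrow> (('h \<Rightarrow>\<^sub>L 'h) \<Rightarrow> complex) \<Rightarrow> bool"
  where "faithful_on M \<tau> \<longleftrightarrow> (\<forall>x\<in>M. \<tau> (cadjoint x o\<^sub>L x) = 0 \<longrightarrow> x = 0)"

text \<open>
  The least upper bound in the set of self-adjoint elements of \<open>M\<close>, ordered by
  \<open>y \<le> x\<close> iff \<open>x - y\<close> is positive.
\<close>

definition is_sup_in ::
    "('h::chilbert_space \<Rightarrow>\<^sub>L 'h) set \<Rightarrow> ('h \<Rightarrow>\<^sub>L 'h) set \<Rightarrow> ('h \<Rightarrow>\<^sub>L 'h) \<Rightarrow> bool"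
  where "is_sup_in M D x \<longleftrightarrow>
    x \<in> M \<and> cadjoint x = x \<and> (\<forall>y\<in>D. positive_op (x - y)) \<and>
    (\<forall>z\<in>M. cadjoint z = z \<and> (\<forall>y\<in>D. positive_op (z - y)) \<longrightarrow> positive_op (z - x))"

text \<open>
  Normality: \<open>\<tau>\<close> preserves suprema of bounded increasing nets of positive elements. The nets
  are given by their ranges, the upward directed sets \<open>D\<close>.
\<close>

definition normal_on ::
    "('h::chilbert_space \<Rightarrow>\<^sub>L 'h) set \<Rightarrow> (('h \<Rightarrow>\<^sub>L 'h) \<Rightarrow> complex) \<Rightarrow> bool"
  where "normal_on M \<tau> \<longleftrightarrow>
    (\<forall>D x. D \<noteq> {} \<and> D \<subseteq> M \<and> (\<forall>y\<in>D. positive_op y) \<and>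
       (\<forall>y\<in>D. \<forall>z\<in>D. \<exists>w\<in>D. positive_op (w - y) \<and> positive_op (w - z)) \<and>
       is_sup_in M D x
       \<longrightarrow> \<tau> x = complex_of_real (SUP y\<in>D. Re (\<tau> y)))"

definition tau_norm :: "(('h::chilbert_space \<Rightarrow>\<^sub>L 'h) \<Rightarrow> complex) \<Rightarrow> ('h \<Rightarrow>\<^sub>L 'h) \<Rightarrow> real"
  where "tau_norm \<tau> x = sqrt (Re (\<tau> (cadjoint x o\<^sub>L x)))"

definition unit_ball :: "('h::chilbert_space \<Rightarrow>\<^sub>L 'h) set \<Rightarrow> ('h \<Rightarrow>\<^sub>L 'h) set"
  where "unit_ball P = {x \<in> P. norm x \<le> 1}"

definition near_contained ::
    "(('h::chilbert_space \<Rightarrow>\<^sub>L 'h) \<Rightarrow> complex) \<Rightarrow> real \<Rightarrow> ('h \<Rightarrow>\<^sub>L 'h) set \<Rightarrow> ('h \<Rightarrow>\<^sub>L 'h) set \<Rightarrow> bool"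
  where "near_contained \<tau> \<gamma> P Q \<longleftrightarrow> (\<forall>x\<in>unit_ball P. \<exists>y\<in>Q. tau_norm \<tau> (x - y) \<le> \<gamma>)"

definition christensen_dist ::
    "(('h::chilbert_space \<Rightarrow>\<^sub>L 'h) \<Rightarrow> complex) \<Rightarrow> ('h \<Rightarrow>\<^sub>L 'h) set \<Rightarrow> ('h \<Rightarrow>\<^sub>L 'h) set \<Rightarrow> real"
  where "christensen_dist \<tau> P Q =
    Inf {\<gamma>. \<gamma> > 0 \<and> near_contained \<tau> \<gamma> P Q \<and> near_contained \<tau> \<gamma> Q P}"

definition mashood_taylor_dist ::
    "(('h::chilbert_space \<Rightarrow>\<^sub>L 'h) \<Rightarrow> complex) \<Rightarrow> ('h \<Rightarrow>\<^sub>L 'h) set \<Rightarrow> ('h \<Rightarrow>\<^sub>L 'h) set \<Rightarrow> real"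
  where "mashood_taylor_dist \<tau> P Q =
    max (SUP x\<in>unit_ball P. INF y\<in>unit_ball Q. tau_norm \<tau> (x - y))
        (SUP y\<in>unit_ball Q. INF x\<in>unit_ball P. tau_norm \<tau> (x - y))"

end

theory Submission
  imports Defs "HOL-Computational_Algebra.Polynomial"
begin

text \<open>
  The nearest-point projection onto the unit ball of \<open>M\<close> for the trace norm sends \<open>y = u|y|\<close> to
  \<open>u min(|y|, 1)\<close>, so clipping \<open>y \<in> Q\<close> in this way does not increase its distance to any \<open>x\<close> in the
  unit ball. As \<open>Q\<close> need not be closed, \<open>u min(|y|, 1) = y f(y\<^sup>*y)\<close> with \<open>f t = min(1, t\<^sup>-\<^sup>1\<^sup>/\<^sup>2)\<close> is
  replaced by \<open>y b(y\<^sup>*y)\<close>, where \<open>b\<close> is a Bernstein polynomial of \<open>f\<close>. All estimates are inequalities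
  between polynomials in \<open>y\<^sup>*y\<close> that lie in the cone spanned by \<open>t\<^sup>i (1 - t)\<^sup>j q(t)\<^sup>2\<close>, on which the trace
  and the vector states are nonnegative because \<open>1 - T\<close> has a square root in \<open>M\<close> whenever
  \<open>\<parallel>T\<parallel> < 1\<close>; Cauchy-Schwarz applied to each Bernstein term, weighted by \<open>f(k/n)\<close>, plays the role of the
  Hoelder inequality for the trace.
\<close>

subsection \<open>Bernstein approximation under positive functionals\<close>

text \<open>These are formal polynomials rather than functions because they are later evaluated at
  an operator; \<open>poly_bern\<close> links them to the real Bernstein functions.\<close>

definition bern :: "nat \<Rightarrow> nat \<Rightarrow> real poly"
  where "bern n k = smult (of_nat (n choose k)) ([:0, 1:] ^ k * [:1, -1:] ^ (n - k))"

lemma poly_bern: "poly (bern n k) x = Bernstein n k x"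
  by (simp add: bern_def Bernstein_def)

lemma sum_bern: "(\<Sum>k\<le>n. bern n k) = 1"
proof (rule poly_ext)
  show "poly (\<Sum>k\<le>n. bern n k) x = poly 1 x" for x
    by (simp add: poly_sum poly_bern)
qed

text \<open>This is the binomial variance \<open>n * x * (1 - x)\<close> divided by the square of
  \<open>n\<close>; it follows pointwise from the first two factorial moments.\<close>

lemma second_moment_bern:
  assumes "n > 0"
  shows "(\<Sum>k\<le>n. [:- (k / n), 1:]\<^sup>2 * bern n k) = smult (1 / n) ([:0, 1:] * [:1, -1:])"
proof (rule poly_ext)
  fix x :: real
  have s: "(\<Sum>k\<le>n. (real k - n * x)\<^sup>2 * Bernstein n k x) = n * x * (1 - x)"
  proof -
    have "(\<Sum>k\<le>n. (real k - n * x)\<^sup>2 * Bernstein n k x) =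
      (\<Sum>k\<le>n. real k * (real k - 1) * Bernstein n k x) + (1 - 2 * n * x) * (\<Sum>k\<le>n. real k * Bernstein n k x)
      + (n * x)\<^sup>2 * (\<Sum>k\<le>n. Bernstein n k x)"
      unfolding sum_distrib_left sum.distrib[symmetric]
      by (intro sum.cong) (auto simp: power2_eq_square algebra_simps)
    then show ?thesis
      unfolding sum_kk_Bernstein sum_k_Bernstein sum_Bernstein
      by (simp add: power2_eq_square algebra_simps)
  qed
  have "poly (\<Sum>k\<le>n. [:- (k / n), 1:]\<^sup>2 * bern n k) x =
      (\<Sum>k\<le>n. (x - k / n)\<^sup>2 * Bernstein n k x)"
    by (simp add: poly_sum poly_bern algebra_simps)
  also have "\<dots> = (\<Sum>k\<le>n. (real k - n * x)\<^sup>2 * Bernstein n k x) / (real n)\<^sup>2"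
    unfolding sum_divide_distrib
    using assms by (intro sum.cong) (auto simp: power2_eq_square field_simps)
  also have "\<dots> = poly (smult (1 / n) ([:0, 1:] * [:1, -1:])) x"
    using assms unfolding s by (simp add: power2_eq_square field_simps)
  finally show "poly (\<Sum>k\<le>n. [:- (k / n), 1:]\<^sup>2 * bern n k) x = \<dots>" .
qed

text \<open>The identity E f^2 - (E f)^2 = E (f - E f)^2 for the binomial weights, which sum to 1.
  It exhibits the Jensen gap as a sum of squares times Bernstein polynomials, hence as an element of
  the positive cone.\<close>

lemma variance_bern:
  fixes f :: "nat \<Rightarrow> real" and n :: nat
  defines "b \<equiv> (\<Sum>k\<le>n. smult (f k) (bern n k))"
  shows "(\<Sum>k\<le>n. smult ((f k)\<^sup>2) (bern n k)) - b\<^sup>2 = (\<Sum>k\<le>n. ([:f k:] - b)\<^sup>2 * bern n k)"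
proof -
  have "([:f k:] - b)\<^sup>2 * bern n k = smult ((f k)\<^sup>2) (bern n k) - 2 * b * smult (f k) (bern n k)
      + b\<^sup>2 * bern n k" for k
  proof -
    have "smult c p = [:c:] * p" for c and p :: "real poly" by simp
    moreover have "[:(f k)\<^sup>2:] = [:f k:]\<^sup>2" by (simp add: power2_eq_square)
    ultimately show ?thesis by (simp only:) (simp only: power2_eq_square algebra_simps)
  qed
  then have "(\<Sum>k\<le>n. ([:f k:] - b)\<^sup>2 * bern n k) = (\<Sum>k\<le>n. smult ((f k)\<^sup>2) (bern n k))
      - 2 * b * (\<Sum>k\<le>n. smult (f k) (bern n k)) + b\<^sup>2 * (\<Sum>k\<le>n. bern n k)"
    by (simp add: sum.distrib sum_subtractf sum_distrib_left)
  then show ?thesis by (simp add: sum_bern b_def[symmetric] power2_eq_square)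
qed

text \<open>Common abstraction of the trace and of a vector state, each evaluated at p(a) with a =
  |y|^2 / R. Positivity is asked on generators of the cone, where operator square roots can certify
  it. The value at 1 is left free, since for a vector state it is the squared norm of the
  vector.\<close>

locale unit_interval_functional =
  fixes \<sigma> :: "real poly \<Rightarrow> real"
  assumes add: "\<sigma> (p + q) = \<sigma> p + \<sigma> q"
    and smult: "\<sigma> (smult c p) = c * \<sigma> p"
    and nonneg: "0 \<le> \<sigma> ([:0, 1:] ^ i * [:1, -1:] ^ j * p\<^sup>2)"
begin

lemma zero: "\<sigma> 0 = 0"
  using smult[of 0 0] by simp

lemma diff: "\<sigma> (p - q) = \<sigma> p - \<sigma> q"
  using add[of p "smult (-1) q"] smult[of "-1" q] by simp

lemma sum: "\<sigma> (\<Sum>k\<in>A. g k) = (\<Sum>k\<in>A. \<sigma> (g k))"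
  by (induction A rule: infinite_finite_induct) (auto simp: zero add)

lemma nonneg_bern: "0 \<le> \<sigma> (p\<^sup>2 * bern n k)"
  using nonneg[of k "n - k" p] by (simp add: bern_def smult mult_ac)

lemma nonneg_X_bern: "0 \<le> \<sigma> ([:0, 1:] * (p\<^sup>2 * bern n k))"
proof -
  have e: "[:0, 1:] * (p\<^sup>2 * bern n k)
      = smult (of_nat (n choose k)) ([:0, 1:] ^ Suc k * [:1, -1:] ^ (n - k) * p\<^sup>2)"
    unfolding bern_def by (simp only: power_Suc mult_ac mult_smult_right mult_smult_left)
  show ?thesis
    unfolding e smult using nonneg[of "Suc k" "n - k" p] by (intro mult_nonneg_nonneg) auto
qed

text \<open>Controls the error of replacing the variable by the node k/n. Each term is bounded
  through 2 delta |u| <= delta^2 + u^2; after summation the second moment carries a factor 1/n, and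
  n = m^2 with delta = 1/m balances the two contributions.\<close>

lemma first_moment_bound:
  fixes m n :: nat
  assumes m: "m > 0" and n: "n = m\<^sup>2" and g: "\<And>k. k \<le> n \<Longrightarrow> \<bar>g k\<bar> \<le> G"
  shows "\<bar>\<Sum>k\<le>n. g k * \<sigma> ([:- (k / n), 1:] * bern n k)\<bar> \<le> G / m * \<sigma> 1"
proof -
  define \<delta> where "\<delta> = 1 / real m"
  have d: "\<delta> > 0" using m by (simp add: \<delta>_def)
  define h where "h k = (\<delta> * \<sigma> (bern n k) + \<sigma> ([:- (k / n), 1:]\<^sup>2 * bern n k) / \<delta>) / 2" for k
  \<comment> \<open>The values c = 1 and c = -1 give the two signs needed to bound an absolute
    value.\<close>
  have sq: "0 \<le> \<delta>\<^sup>2 * \<sigma> (bern n k) + \<sigma> ([:- (k / n), 1:]\<^sup>2 * bern n k)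
      + 2 * c * \<delta> * \<sigma> ([:- (k / n), 1:] * bern n k)" if "c\<^sup>2 = 1" for k c
  proof -
    have "(u + [:c * \<delta>:])\<^sup>2 * B = smult (\<delta>\<^sup>2) B + u\<^sup>2 * B + smult (2 * c * \<delta>) (u * B)" for u B
    proof (rule poly_ext)
      fix x
      have "(poly u x + c * \<delta>)\<^sup>2 = c\<^sup>2 * \<delta>\<^sup>2 + (poly u x)\<^sup>2 + 2 * c * \<delta> * poly u x"
        by (simp add: power2_eq_square algebra_simps)
      then show "poly ((u + [:c * \<delta>:])\<^sup>2 * B) x
          = poly (smult (\<delta>\<^sup>2) B + u\<^sup>2 * B + smult (2 * c * \<delta>) (u * B)) x"
        using that by (simp add: algebra_simps)
    qed
    then show ?thesis
      using nonneg_bern[of "[:- (k / n), 1:] + [:c * \<delta>:]" n k] by (simp add: add smult del: add_pCons)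
  qed
  have h: "\<bar>\<sigma> ([:- (k / n), 1:] * bern n k)\<bar> \<le> h k" for k
  proof -
    have "2 * \<delta> * \<bar>\<sigma> ([:- (k / n), 1:] * bern n k)\<bar>
        \<le> \<delta>\<^sup>2 * \<sigma> (bern n k) + \<sigma> ([:- (k / n), 1:]\<^sup>2 * bern n k)"
      using sq[of 1 k] sq[of "-1" k] by (simp add: abs_if)
    then show ?thesis using d by (simp add: h_def field_simps power2_eq_square)
  qed
  have n0: "n > 0" using m n by simp
  have G: "G \<ge> 0" using g[of 0] by linarith
  \<comment> \<open>The comparison of X (1 - X) with 1 takes place inside the cone: 1 - X (1 - X) =
    X + (1 - X)^2.\<close>
  have "[:1:] - [:0, 1:] * [:1, -1:] = [:0, 1:] ^ 1 * [:1, -1:] ^ 0 * 1\<^sup>2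
      + [:0, 1:] ^ 0 * [:1, -1:] ^ 2 * (1 :: real poly)\<^sup>2"
    by (simp add: power2_eq_square)
  then have "\<sigma> (1 - [:0, 1:] * [:1, -1:]) \<ge> 0"
    using nonneg[of 1 0 1] nonneg[of 0 2 1] by (simp only: add one_pCons)
  then have v: "\<sigma> ([:0, 1:] * [:1, -1:]) \<le> \<sigma> 1" by (simp add: diff)
  have "(\<Sum>k\<le>n. h k) = (\<delta> * \<sigma> (\<Sum>k\<le>n. bern n k)
      + \<sigma> (\<Sum>k\<le>n. [:- (k / n), 1:]\<^sup>2 * bern n k) / \<delta>) / 2"
    by (simp add: h_def sum sum.distrib sum_distrib_left sum_divide_distrib add_divide_distrib)
  also have "\<dots> = (\<delta> * \<sigma> 1 + \<delta> * \<sigma> ([:0, 1:] * [:1, -1:])) / 2"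
    unfolding sum_bern second_moment_bern[OF n0] smult
    using m by (simp add: n \<delta>_def power2_eq_square)
  also have "\<dots> \<le> \<delta> * \<sigma> 1"
    using mult_left_mono[OF v, of \<delta>] d by simp
  finally have H: "(\<Sum>k\<le>n. h k) \<le> \<delta> * \<sigma> 1" .
  have "\<bar>\<Sum>k\<le>n. g k * \<sigma> ([:- (k / n), 1:] * bern n k)\<bar> \<le> (\<Sum>k\<le>n. G * h k)"
    using g h G by (intro order_trans[OF sum_abs] sum_mono) (auto simp: abs_mult intro!: mult_mono)
  also have "\<dots> \<le> G * (\<delta> * \<sigma> 1)"
    unfolding sum_distrib_left[symmetric] by (intro mult_left_mono H G)
  finally show ?thesis by (simp add: \<delta>_def)
qed

end

text \<open>The value of \<open>t \<mapsto> min(1, t\<^sup>-\<^sup>1\<^sup>/\<^sup>2)\<close> at \<open>R k / n\<close>, without a division by zero at \<open>k = 0\<close>.\<close>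

definition clip_weight :: "real \<Rightarrow> nat \<Rightarrow> nat \<Rightarrow> real"
  where "clip_weight R n k = 1 / sqrt (max 1 (R * (k / n)))"

text \<open>The n-th Bernstein approximation on [0, 1] of t mapped to min(1, (R t)^(-1/2)); the
  variable stands for |y|^2 / R.\<close>

definition clip_poly :: "real \<Rightarrow> nat \<Rightarrow> real poly"
  where "clip_poly R n = (\<Sum>k\<le>n. smult (clip_weight R n k) (bern n k))"

lemma clip_weight_bounds: "0 < clip_weight R n k" "clip_weight R n k \<le> 1"
  by (auto simp: clip_weight_def)

lemma inverse_clip_weight_sq: "1 / (clip_weight R n k)\<^sup>2 = max 1 (R * (k / n))"
  by (simp add: clip_weight_def power_divide)

section \<open>Norm and distance estimates for the clipping polynomial\<close>

context unit_interval_functional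
begin

lemma X_bern: "\<sigma> ([:0, 1:] * bern n k) = k / n * \<sigma> (bern n k) + \<sigma> ([:- (k / n), 1:] * bern n k)"
proof -
  have "[:0, 1:] * bern n k = smult (k / n) (bern n k) + [:- (k / n), 1:] * bern n k"
    by (rule poly_ext) (simp add: algebra_simps)
  then show ?thesis by (simp only: add smult)
qed

text \<open>Jensen's inequality for the square, multiplied by X: the gap is X times the right-hand
  side of \<open>variance_bern\<close>, and each of its terms is in the cone.\<close>

lemma clip_poly_variance:
  "\<sigma> ([:0, 1:] * (clip_poly R n)\<^sup>2) \<le> (\<Sum>k\<le>n. (clip_weight R n k)\<^sup>2 * \<sigma> ([:0, 1:] * bern n k))"
proof -
  have "0 \<le> (\<Sum>k\<le>n. \<sigma> ([:0, 1:] * (([:clip_weight R n k:] - clip_poly R n)\<^sup>2 * bern n k)))"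
    by (intro sum_nonneg nonneg_X_bern)
  also have "\<dots> = \<sigma> ([:0, 1:] * ((\<Sum>k\<le>n. smult ((clip_weight R n k)\<^sup>2) (bern n k)) - (clip_poly R n)\<^sup>2))"
    unfolding clip_poly_def variance_bern sum_distrib_left sum ..
  also have "\<dots> = (\<Sum>k\<le>n. (clip_weight R n k)\<^sup>2 * \<sigma> ([:0, 1:] * bern n k)) - \<sigma> ([:0, 1:] * (clip_poly R n)\<^sup>2)"
    unfolding right_diff_distrib diff sum_distrib_left sum mult_smult_right smult ..
  finally show ?thesis by simp
qed

text \<open>At each node the squared weight times R k/n is at most 1, and trading X for k/n costs a
  first moment error. For vector states this becomes the operator norm bound on the clipped
  element.\<close>

lemma clip_poly_norm_bound:
  fixes m n :: nat
  assumes m: "m > 0" and n: "n = m\<^sup>2" and R: "R > 0"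
  shows "R * \<sigma> ([:0, 1:] * (clip_poly R n)\<^sup>2) \<le> (1 + R / m) * \<sigma> 1"
proof -
  let ?f = "clip_weight R n"
  have "R * \<sigma> ([:0, 1:] * (clip_poly R n)\<^sup>2) \<le> R * (\<Sum>k\<le>n. (?f k)\<^sup>2 * \<sigma> ([:0, 1:] * bern n k))"
    using R by (intro mult_left_mono clip_poly_variance) auto
  also have "\<dots> = (\<Sum>k\<le>n. (?f k)\<^sup>2 * (R * (k / n)) * \<sigma> (bern n k))
      + (\<Sum>k\<le>n. (R * (?f k)\<^sup>2) * \<sigma> ([:- (k / n), 1:] * bern n k))"
    unfolding sum_distrib_left sum.distrib[symmetric] X_bern
    by (intro sum.cong) (auto simp: algebra_simps)
  also have "\<dots> \<le> (\<Sum>k\<le>n. 1 * \<sigma> (bern n k)) + R / m * \<sigma> 1"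
  proof (intro add_mono sum_mono mult_right_mono)
    fix k
    have "R * (k / n) \<le> 1 / (?f k)\<^sup>2" unfolding inverse_clip_weight_sq by simp
    then show "(?f k)\<^sup>2 * (R * (k / n)) \<le> 1"
      using clip_weight_bounds(1)[of R n k] by (simp add: field_simps)
    show "0 \<le> \<sigma> (bern n k)" using nonneg_bern[of 1 n k] by simp
  next
    have "\<bar>R * (?f k)\<^sup>2\<bar> \<le> R" for k
      using clip_weight_bounds[of R n k] R by (auto simp: abs_mult intro!: mult_left_le power_le_one)
    from first_moment_bound[OF m n this]
    show "(\<Sum>k\<le>n. (R * (?f k)\<^sup>2) * \<sigma> ([:- (k / n), 1:] * bern n k)) \<le> R / m * \<sigma> 1"
      by (meson abs_le_D1)
  qed
  also have "\<dots> = (1 + R / m) * \<sigma> 1"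
    by (simp add: sum[symmetric] sum_bern algebra_simps)
  finally show ?thesis .
qed

text \<open>Here \<open>c k\<close> will be the trace inner product of x with the k-th Bernstein
  piece of y, and the hypothesis is Cauchy-Schwarz weighted by \<open>clip_weight\<close>. A weight
  below 1 makes the two terms of the hypothesis equal up to a first moment error. With z the clipped
  y, the conclusion will read <y - z, x> <= <y - z, z> + R / (2m).\<close>

lemma clip_poly_distance_bound:
  fixes m n :: nat
  assumes m: "m > 0" and n: "n = m\<^sup>2" and R: "R > 0"
    and c: "\<And>k. k \<le> n \<Longrightarrow> c k \<le> (clip_weight R n k * (R * \<sigma> ([:0, 1:] * bern n k))
      + \<sigma> (bern n k) / clip_weight R n k) / 2"
  shows "(\<Sum>k\<le>n. (1 - clip_weight R n k) * c k)
    \<le> R * \<sigma> ([:0, 1:] * ((1 - clip_poly R n) * clip_poly R n)) + R / (2 * m) * \<sigma> 1"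
proof -
  let ?f = "clip_weight R n"
  let ?X = "\<lambda>k. \<sigma> ([:0, 1:] * bern n k)"
  let ?e = "\<lambda>k. \<sigma> ([:- (k / n), 1:] * bern n k)"
  have "(\<Sum>k\<le>n. (1 - ?f k) * c k) \<le> (\<Sum>k\<le>n. R * ((?f k - (?f k)\<^sup>2) * ?X k)
      + (- R * (1 - ?f k) * ?f k / 2) * ?e k)"
  proof (rule sum_mono)
    fix k assume k: "k \<in> {..n}"
    have f: "0 < ?f k" "?f k \<le> 1" by (rule clip_weight_bounds)+
    have "(1 - ?f k) * c k \<le> (1 - ?f k) * ((?f k * (R * ?X k) + \<sigma> (bern n k) / ?f k) / 2)"
      using c k f by (intro mult_left_mono) auto
    also have "\<dots> = R * ((?f k - (?f k)\<^sup>2) * ?X k) + (- R * (1 - ?f k) * ?f k / 2) * ?e k"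
    \<comment> \<open>If the weight is 1, both sides vanish. Otherwise the maximum in
      \<open>clip_weight\<close> is R k/n, so 1 / f = f R k/n, and \<open>X_bern\<close> turns the
      node back into X minus the error.\<close>
    proof (cases "?f k = 1")
      case False
      then have "1 / (?f k)\<^sup>2 = R * (k / n)"
        using inverse_clip_weight_sq[of R n k] by (auto simp: clip_weight_def max_def)
      moreover have "1 / ?f k = ?f k * (1 / (?f k)\<^sup>2)"
        using f by (simp add: power2_eq_square)
      ultimately have e: "1 / ?f k = ?f k * (R * (k / n))" by simp
      have "\<sigma> (bern n k) / ?f k = ?f k * (R * (k / n)) * \<sigma> (bern n k)"
        unfolding e[symmetric] by simp
      also have "\<dots> = ?f k * R * (?X k - ?e k)" unfolding X_bern by simp
      finally have e: "\<sigma> (bern n k) / ?f k = ?f k * R * (?X k - ?e k)" .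
      show ?thesis unfolding e by (simp add: power2_eq_square field_simps)
    qed simp
    finally show "(1 - ?f k) * c k \<le> R * ((?f k - (?f k)\<^sup>2) * ?X k) + (- R * (1 - ?f k) * ?f k / 2) * ?e k" .
  qed
  also have "\<dots> = R * (\<Sum>k\<le>n. (?f k - (?f k)\<^sup>2) * ?X k) + (\<Sum>k\<le>n. (- R * (1 - ?f k) * ?f k / 2) * ?e k)"
    by (simp only: sum.distrib sum_distrib_left)
  also have "\<dots> \<le> R * \<sigma> ([:0, 1:] * ((1 - clip_poly R n) * clip_poly R n)) + R / 2 / m * \<sigma> 1"
  proof (intro add_mono mult_left_mono)
    have "\<sigma> ([:0, 1:] * ((1 - clip_poly R n) * clip_poly R n))
        = \<sigma> ([:0, 1:] * clip_poly R n) - \<sigma> ([:0, 1:] * (clip_poly R n)\<^sup>2)"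
      unfolding diff[symmetric] by (simp add: algebra_simps power2_eq_square)
    moreover have "\<sigma> ([:0, 1:] * clip_poly R n) = (\<Sum>k\<le>n. ?f k * ?X k)"
      unfolding clip_poly_def sum_distrib_left sum mult_smult_right smult ..
    ultimately show "(\<Sum>k\<le>n. (?f k - (?f k)\<^sup>2) * ?X k) \<le> \<sigma> ([:0, 1:] * ((1 - clip_poly R n) * clip_poly R n))"
      using clip_poly_variance[of R n] by (simp add: left_diff_distrib sum_subtractf)
  next
    have "\<bar>- R * (1 - ?f k) * ?f k / 2\<bar> \<le> R / 2" for k
    proof -
      have "(1 - ?f k) * ?f k \<le> 1 * 1" using clip_weight_bounds[of R n k] by (intro mult_mono) auto
      then have "R * ((1 - ?f k) * ?f k) \<le> R" using R by simp
      then show ?thesis using clip_weight_bounds[of R n k] R by (simp add: abs_mult mult.assoc)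
    qed
    from first_moment_bound[OF m n this]
    show "(\<Sum>k\<le>n. (- R * (1 - ?f k) * ?f k / 2) * ?e k) \<le> R / 2 / m * \<sigma> 1"
      by (meson abs_le_D1)
  qed (use R in simp)
  finally show ?thesis by simp
qed

end

subsection \<open>Star algebras of bounded operators\<close>

lemma cinner_cadjoint_right:
  assumes "T \<in> bounded_operators"
  shows "cinner x (cadjoint T y) = cinner (T x) y"
  by (metis assms cinner_cadjoint cinner_commute)

lemma cadjoint_cadjoint:
  assumes "T \<in> bounded_operators"
  shows "cadjoint (cadjoint T) = T"
  by (rule cadjoint_unique) (simp add: assms cinner_cadjoint_right)

lemma cadjoint_compose:
  assumes "S \<in> bounded_operators" "T \<in> bounded_operators"
  shows "cadjoint (S o\<^sub>L T) = cadjoint T o\<^sub>L cadjoint S"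
  by (rule cadjoint_unique) (simp add: assms cinner_cadjoint)

lemma cadjoint_add:
  assumes "S \<in> bounded_operators" "T \<in> bounded_operators"
  shows "cadjoint (S + T) = cadjoint S + cadjoint T"
  by (rule cadjoint_unique)
    (simp add: assms cinner_cadjoint blinfun.add_left cinner_add_left cinner_add_right)

lemma cadjoint_scaleC_op:
  assumes "T \<in> bounded_operators"
  shows "cadjoint (scaleC_op a T) = scaleC_op (cnj a) (cadjoint T)"
  by (rule cadjoint_unique)
    (simp add: assms cinner_cadjoint scaleC_op_apply cinner_scaleC_left cinner_scaleC_right)

lemma scaleR_conv_scaleC_op: "r *\<^sub>R T = scaleC_op (complex_of_real r) T"
  by (rule blinfun_eqI) (simp add: scaleC_op_apply blinfun.scaleR_left scaleR_scaleC)

lemma cadjoint_scaleR: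
  assumes "T \<in> bounded_operators"
  shows "cadjoint (r *\<^sub>R T) = r *\<^sub>R cadjoint T"
  by (simp add: assms scaleR_conv_scaleC_op cadjoint_scaleC_op)

lemma cadjoint_id: "cadjoint id_blinfun = id_blinfun"
  by (rule cadjoint_unique) simp

lemma norm_cadjoint_le:
  assumes "T \<in> bounded_operators"
  shows "norm (cadjoint T) \<le> norm T"
proof (rule norm_blinfun_bound)
  fix x
  show "norm (cadjoint T x) \<le> norm T * norm x"
  proof (cases "norm (cadjoint T x) = 0")
    case False
    have "(norm (cadjoint T x))\<^sup>2 = cmod (cinner x (T (cadjoint T x)))"
      by (simp add: cinner_cadjoint[OF assms, symmetric] cinner_self norm_power)
    also have "\<dots> \<le> norm x * (norm T * norm (cadjoint T x))"
      by (rule order_trans[OF cauchy_schwarz]) (intro mult_left_mono norm_blinfun norm_ge_zero)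
    finally have "norm (cadjoint T x) * norm (cadjoint T x) \<le> (norm T * norm x) * norm (cadjoint T x)"
      by (simp add: power2_eq_square mult_ac)
    then show ?thesis by (rule mult_right_le_imp_le) (use False in simp)
  qed simp
qed simp

lemma cinner_cadjoint_compose_self:
  assumes "T \<in> bounded_operators"
  shows "cinner ((cadjoint T o\<^sub>L T) \<xi>) \<xi> = complex_of_real ((norm (T \<xi>))\<^sup>2)"
  by (simp add: cinner_cadjoint[OF assms] cinner_self)

lemma blinfun_compose_scaleR:
  "(r *\<^sub>R S) o\<^sub>L T = r *\<^sub>R (S o\<^sub>L T)" "S o\<^sub>L (r *\<^sub>R T) = r *\<^sub>R (S o\<^sub>L T)"
  by (rule blinfun_eqI; simp add: blinfun.bilinear_simps)+

lemma blinfun_compose_distrib: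
  "(S + T) o\<^sub>L U = (S o\<^sub>L U) + (T o\<^sub>L U)" "U o\<^sub>L (S + T) = (U o\<^sub>L S) + (U o\<^sub>L T)"
  "(S - T) o\<^sub>L U = (S o\<^sub>L U) - (T o\<^sub>L U)" "U o\<^sub>L (S - T) = (U o\<^sub>L S) - (U o\<^sub>L T)"
  by (rule blinfun_eqI; simp add: blinfun.bilinear_simps)+

lemma blinfun_compose_id [simp]: "id_blinfun o\<^sub>L T = T" "T o\<^sub>L id_blinfun = T"
  by (rule blinfun_eqI; simp)+

lemma blinfun_compose_assoc: "(S o\<^sub>L T) o\<^sub>L U = S o\<^sub>L (T o\<^sub>L U)"
  by (rule blinfun_eqI) simp

locale unital_star_algebra =
  fixes A :: "('h::chilbert_space \<Rightarrow>\<^sub>L 'h) set"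
  assumes star: "star_subalgebra A" and id_in: "id_blinfun \<in> A"
begin

lemma
  shows bop: "x \<in> A \<Longrightarrow> x \<in> bounded_operators"
    and zero_in: "0 \<in> A"
    and add_in: "x \<in> A \<Longrightarrow> y \<in> A \<Longrightarrow> x + y \<in> A"
    and scaleC_in: "x \<in> A \<Longrightarrow> scaleC_op c x \<in> A"
    and scaleR_in: "x \<in> A \<Longrightarrow> r *\<^sub>R x \<in> A"
    and compose_in: "x \<in> A \<Longrightarrow> y \<in> A \<Longrightarrow> x o\<^sub>L y \<in> A"
    and cadjoint_in: "x \<in> A \<Longrightarrow> cadjoint x \<in> A"
  using star by (auto simp: star_subalgebra_def scaleR_conv_scaleC_op)

lemma diff_in: "x \<in> A \<Longrightarrow> y \<in> A \<Longrightarrow> x - y \<in> A"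
  using add_in[of x "(-1) *\<^sub>R y"] scaleR_in[of y "-1"] by simp

lemmas closed_ops = zero_in id_in add_in diff_in scaleC_in scaleR_in compose_in cadjoint_in

lemma cadjoint_diff: "x \<in> A \<Longrightarrow> y \<in> A \<Longrightarrow> cadjoint (x - y) = cadjoint x - cadjoint y"
  using cadjoint_add[of x "(-1) *\<^sub>R y"] cadjoint_scaleR[of y "-1"] scaleR_in[of y "-1"]
  by (simp add: bop)

end

section \<open>Polynomial calculus in a single operator\<close>

definition op_poly :: "('a::real_normed_vector \<Rightarrow>\<^sub>L 'a) \<Rightarrow> real poly \<Rightarrow> ('a \<Rightarrow>\<^sub>L 'a)"
  where "op_poly a p = fold_coeffs (\<lambda>c T. c *\<^sub>R id_blinfun + (a o\<^sub>L T)) p 0"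

lemma op_poly_0 [simp]: "op_poly a 0 = 0"
  by (simp add: op_poly_def)

lemma op_poly_pCons [simp]: "op_poly a (pCons c p) = c *\<^sub>R id_blinfun + (a o\<^sub>L op_poly a p)"
  by (cases "c = 0 \<and> p = 0") (auto simp: op_poly_def)

lemma op_poly_1 [simp]: "op_poly a 1 = id_blinfun"
  by (simp add: one_pCons)

lemma op_poly_add: "op_poly a (p + q) = op_poly a p + op_poly a q"
  by (induction p q rule: poly_induct2) (auto simp: blinfun_compose_distrib scaleR_left_distrib)

lemma op_poly_smult: "op_poly a (smult c p) = c *\<^sub>R op_poly a p"
  by (induction p) (auto simp: blinfun_compose_scaleR scaleR_right_distrib)

lemma op_poly_mult: "op_poly a (p * q) = op_poly a p o\<^sub>L op_poly a q"
  by (induction p)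
    (auto simp: blinfun_compose_scaleR blinfun_compose_distrib op_poly_add op_poly_smult blinfun_compose_assoc)

lemma op_poly_commute:
  assumes "a o\<^sub>L s = s o\<^sub>L a"
  shows "op_poly a p o\<^sub>L s = s o\<^sub>L op_poly a p"
proof (induction p)
  case (pCons c p)
  have "a o\<^sub>L (op_poly a p o\<^sub>L s) = s o\<^sub>L (a o\<^sub>L op_poly a p)"
    unfolding pCons.IH(1) by (simp only: blinfun_compose_assoc[symmetric] assms)
  then show ?case
    by (simp add: blinfun_compose_distrib blinfun_compose_scaleR blinfun_compose_assoc)
qed simp

context unital_star_algebra
begin

lemma op_poly_in: "a \<in> A \<Longrightarrow> op_poly a p \<in> A"
  by (induction p) (auto intro!: closed_ops)

text \<open>The coefficients are real, and the products reversed by the adjoint commute.\<close>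

lemma cadjoint_op_poly:
  assumes "a \<in> A" "cadjoint a = a"
  shows "cadjoint (op_poly a p) = op_poly a p"
proof (induction p)
  case 0
  have "cadjoint (0 *\<^sub>R a) = 0 *\<^sub>R cadjoint a"
    using assms by (intro cadjoint_scaleR bop)
  then show ?case by simp
next
  case (pCons c p)
  have "op_poly a p o\<^sub>L a = a o\<^sub>L op_poly a p" by (rule op_poly_commute) simp
  then show ?case
    using assms pCons.IH
    by (simp add: cadjoint_add cadjoint_scaleR cadjoint_compose cadjoint_id bop op_poly_in closed_ops)
qed

end

section \<open>Norm closedness and operator square roots\<close>

lemma closed_bounded_operators: "closed (bounded_operators :: ('h::chilbert_space \<Rightarrow>\<^sub>L 'h) set)"
proof -
  have "closed {T :: 'h \<Rightarrow>\<^sub>L 'h. T (c *\<^sub>C x) = c *\<^sub>C T x}" for c x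
    by (intro closed_Collect_eq continuous_intros
        bounded_linear.continuous_on[OF bounded_linear_scaleC])
  then have "closed (\<Inter>c. \<Inter>x. {T :: 'h \<Rightarrow>\<^sub>L 'h. T (c *\<^sub>C x) = c *\<^sub>C T x})"
    by (intro closed_INT ballI)
  also have "(\<Inter>c. \<Inter>x. {T :: 'h \<Rightarrow>\<^sub>L 'h. T (c *\<^sub>C x) = c *\<^sub>C T x}) = bounded_operators"
    by (auto simp: bounded_operators_def)
  finally show ?thesis .
qed

lemma closed_commuting: "closed {x :: 'a::real_normed_vector \<Rightarrow>\<^sub>L 'a. x o\<^sub>L y = y o\<^sub>L x}"
  by (intro closed_Collect_eq bounded_bilinear.continuous_on[OF bounded_bilinear_blinfun_compose]
      continuous_intros)

text \<open>The algebra is its own double commutant, and every commutant is cut out by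
  norm-continuous equations. This provides the completeness behind the fixed point argument for
  square roots.\<close>

lemma closed_von_neumann_algebra:
  fixes M :: "('h::chilbert_space \<Rightarrow>\<^sub>L 'h) set"
  assumes "von_neumann_algebra M"
  shows "closed M"
proof -
  have "closed (commutant B)" for B :: "('h \<Rightarrow>\<^sub>L 'h) set"
  proof -
    have "commutant B = bounded_operators \<inter> (\<Inter>y\<in>B. {x. x o\<^sub>L y = y o\<^sub>L x})"
      by (auto simp: commutant_def)
    then show ?thesis
      by (simp add: closed_Int closed_INT closed_bounded_operators closed_commuting)
  qed
  from this[of "commutant M"] show ?thesis
    using assms by (simp add: von_neumann_algebra_def)
qed

locale closed_star_algebra = unital_star_algebra +
  assumes closed: "closed A"
begin

text \<open>The square root is \<open>1 - X\<close> for the fixed point \<open>X\<close> of the contraction \<open>X \<mapsto> (T + X\<^sup>2) / 2\<close> on a small ball.\<close>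

lemma sqrt_exists:
  assumes T: "T \<in> A" "cadjoint T = T" and norm_T: "norm T < 1"
  obtains s where "s \<in> A" "cadjoint s = s" "s o\<^sub>L s = id_blinfun - T" "T o\<^sub>L s = s o\<^sub>L T"
proof -
  \<comment> \<open>The smaller root of r^2 - 2 r + norm T = 0: with it \<open>F\<close> maps the
    ball of radius r into itself, and r < 1 is also its contraction constant there. Commutation with
    \<open>T\<close> is built into \<open>S\<close>, so that the fixed point inherits it.\<close>
  define r where "r = 1 - sqrt (1 - norm T)"
  define S where "S = {X \<in> A. X o\<^sub>L T = T o\<^sub>L X} \<inter> cball 0 r"
  define F where "F X = (1/2) *\<^sub>R (T + (X o\<^sub>L X))" for X
  have r: "0 \<le> r" "r < 1" using norm_T by (auto simp: r_def)
  have rr: "norm T + r\<^sup>2 = 2 * r"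
    using norm_T by (simp add: r_def power2_eq_square algebra_simps)
  have bound: "norm (F X) \<le> r" if "norm X \<le> r" for X
  proof -
    have "norm (X o\<^sub>L X) \<le> r\<^sup>2"
      using that r by (intro order_trans[OF norm_blinfun_compose]) (auto simp: power2_eq_square intro!: mult_mono)
    then have "norm (T + (X o\<^sub>L X)) \<le> 2 * r"
      using norm_triangle_ineq[of T "X o\<^sub>L X"] rr by linarith
    then show ?thesis by (simp add: F_def)
  qed
  have "\<exists>!X. X \<in> S \<and> F X = X"
  proof (rule Banach_fix[where c = r])
    have "closed S"
      unfolding S_def Collect_conj_eq Collect_mem_eq by (intro closed_Int closed closed_commuting closed_cball)
    then show "complete S" by (simp add: complete_eq_closed)
    show "S \<noteq> {}" using r by (auto simp: S_def intro!: exI[of _ 0] closed_ops)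
    show "F ` S \<subseteq> S"
    proof safe
      fix X assume X: "X \<in> S"
      then have c: "X o\<^sub>L T = T o\<^sub>L X" by (simp add: S_def)
      have "X o\<^sub>L (X o\<^sub>L T) = T o\<^sub>L (X o\<^sub>L X)"
        unfolding c by (simp only: blinfun_compose_assoc[symmetric] c)
      then have "F X o\<^sub>L T = T o\<^sub>L F X"
        by (simp add: F_def blinfun_compose_distrib blinfun_compose_scaleR blinfun_compose_assoc)
      moreover have "F X \<in> A" using X T by (auto simp: F_def S_def intro!: closed_ops)
      ultimately show "F X \<in> S" using bound[of X] X by (simp add: S_def)
    qed
    show "dist (F X) (F Y) \<le> r * dist X Y" if "X \<in> S" "Y \<in> S" for X Y
    proof -
      have "F X - F Y = (1/2) *\<^sub>R ((X o\<^sub>L (X - Y)) + ((X - Y) o\<^sub>L Y))"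
        by (simp add: F_def blinfun_compose_distrib scaleR_right_diff_distrib[symmetric])
      also have "norm \<dots> \<le> (1/2) * (norm X * norm (X - Y) + norm (X - Y) * norm Y)"
        using norm_triangle_ineq[of "X o\<^sub>L (X - Y)" "(X - Y) o\<^sub>L Y"]
          norm_blinfun_compose[of X "X - Y"] norm_blinfun_compose[of "X - Y" Y] by simp
      also have "\<dots> \<le> (1/2) * (r * norm (X - Y) + norm (X - Y) * r)"
        using that by (intro mult_left_mono add_mono mult_right_mono) (auto simp: S_def)
      finally show ?thesis by (simp add: dist_norm)
    qed
  qed (use r in auto)
  then obtain X where X: "X \<in> S" "F X = X" and uniq: "\<And>Y. Y \<in> S \<Longrightarrow> F Y = Y \<Longrightarrow> Y = X" by blast
  have XA: "X \<in> A" and c: "X o\<^sub>L T = T o\<^sub>L X" and nX: "norm X \<le> r" using X by (auto simp: S_def)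
  \<comment> \<open>The adjoint of \<open>X\<close> is again a fixed point in \<open>S\<close>, so
    uniqueness makes \<open>X\<close> self-adjoint.\<close>
  have adj: "cadjoint X = X"
  proof (rule uniq)
    have "cadjoint (X o\<^sub>L T) = cadjoint (T o\<^sub>L X)" using c by simp
    then have "T o\<^sub>L cadjoint X = cadjoint X o\<^sub>L T"
      using XA T by (simp add: cadjoint_compose bop)
    moreover have "norm (cadjoint X) \<le> r" using norm_cadjoint_le[OF bop[OF XA]] nX by linarith
    ultimately show "cadjoint X \<in> S" using XA by (simp add: S_def cadjoint_in)
    have "cadjoint (F X) = F (cadjoint X)"
      using XA T by (simp add: F_def cadjoint_scaleR cadjoint_add cadjoint_compose bop closed_ops)
    then show "F (cadjoint X) = cadjoint X" using X by simp
  qed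
  show thesis
  proof
    \<comment> \<open>The fixed point equation says X^2 = 2 X - T, whence (1 - X)^2 = 1 - T.\<close>
    have "X o\<^sub>L X = 2 *\<^sub>R F X - T" by (simp add: F_def)
    then show "(id_blinfun - X) o\<^sub>L (id_blinfun - X) = id_blinfun - T"
      using X(2) by (simp add: blinfun_compose_distrib scaleR_2)
    show "cadjoint (id_blinfun - X) = id_blinfun - X"
      using XA adj by (simp add: cadjoint_diff cadjoint_id id_in)
  qed (use XA c in \<open>auto simp: blinfun_compose_distrib closed_ops\<close>)
qed

end

subsection \<open>The trace inner product\<close>

locale tracial_algebra = closed_star_algebra A for A :: "('h::chilbert_space \<Rightarrow>\<^sub>L 'h) set" +
  fixes \<tau> :: "('h \<Rightarrow>\<^sub>L 'h) \<Rightarrow> complex"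
  assumes state: "state_on A \<tau>" and tracial: "tracial_on A \<tau>"
begin

lemma
  shows tau_add: "x \<in> A \<Longrightarrow> y \<in> A \<Longrightarrow> \<tau> (x + y) = \<tau> x + \<tau> y"
    and tau_scaleC: "x \<in> A \<Longrightarrow> \<tau> (scaleC_op c x) = c * \<tau> x"
    and tau_scaleR: "x \<in> A \<Longrightarrow> \<tau> (r *\<^sub>R x) = r * \<tau> x"
    and tau_square: "x \<in> A \<Longrightarrow> \<tau> (cadjoint x o\<^sub>L x) \<in> \<real>\<^sub>\<ge>\<^sub>0"
    and tau_id: "\<tau> id_blinfun = 1"
    and tau_commute: "x \<in> A \<Longrightarrow> y \<in> A \<Longrightarrow> \<tau> (x o\<^sub>L y) = \<tau> (y o\<^sub>L x)"
  using state tracial by (auto simp: state_on_def tracial_on_def scaleR_conv_scaleC_op)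

lemma tau_diff: "x \<in> A \<Longrightarrow> y \<in> A \<Longrightarrow> \<tau> (x - y) = \<tau> x - \<tau> y"
  using tau_add[of x "(-1) *\<^sub>R y"] tau_scaleR[of y "-1"] scaleR_in[of y "-1"] by simp

text \<open>The real inner product underlying the GNS inner product of the trace.\<close>

definition ip :: "('h \<Rightarrow>\<^sub>L 'h) \<Rightarrow> ('h \<Rightarrow>\<^sub>L 'h) \<Rightarrow> real"
  where "ip u v = Re (\<tau> (cadjoint u o\<^sub>L v))"

lemma tau_norm_eq: "tau_norm \<tau> u = sqrt (ip u u)"
  by (simp add: tau_norm_def ip_def)

lemma ip_nonneg: "u \<in> A \<Longrightarrow> 0 \<le> ip u u"
  using tau_square[of u] by (simp add: ip_def complex_nonneg_Reals_iff)

lemma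
  assumes "u \<in> A" "v \<in> A" "w \<in> A"
  shows ip_add_left: "ip (u + v) w = ip u w + ip v w"
    and ip_add_right: "ip w (u + v) = ip w u + ip w v"
    and ip_diff_left: "ip (u - v) w = ip u w - ip v w"
    and ip_diff_right: "ip w (u - v) = ip w u - ip w v"
    and ip_scaleR_left: "ip (r *\<^sub>R u) w = r * ip u w"
    and ip_scaleR_right: "ip w (r *\<^sub>R u) = r * ip w u"
  using assms
  by (simp_all add: ip_def cadjoint_add cadjoint_diff cadjoint_scaleR bop blinfun_compose_distrib
      blinfun_compose_scaleR tau_add tau_diff tau_scaleR closed_ops)

text \<open>Symmetry comes from the reality of \<open>\<tau> ((u + \<i>v)\<^sup>* (u + \<i>v))\<close>.\<close>

lemma ip_commute:
  assumes "u \<in> A" "v \<in> A"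
  shows "ip u v = ip v u"
proof -
  define w where "w = u + scaleC_op \<i> v"
  have scaleC: "scaleC_op c S o\<^sub>L T = scaleC_op c (S o\<^sub>L T)" for c and S T :: "'h \<Rightarrow>\<^sub>L 'h"
    by (rule blinfun_eqI) (simp add: scaleC_op_apply)
  have scaleC': "S o\<^sub>L scaleC_op c T = scaleC_op c (S o\<^sub>L T)" if "S \<in> A" for c and S T :: "'h \<Rightarrow>\<^sub>L 'h"
    using bop[OF that] by (intro blinfun_eqI) (simp add: scaleC_op_apply bounded_operators_def)
  have "\<tau> (cadjoint w o\<^sub>L w) = \<tau> (cadjoint u o\<^sub>L u) + \<tau> (cadjoint v o\<^sub>L v)
      + \<i> * \<tau> (cadjoint u o\<^sub>L v) - \<i> * \<tau> (cadjoint v o\<^sub>L u)"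
    using assms
    by (simp add: w_def cadjoint_add cadjoint_scaleC_op bop blinfun_compose_distrib
        scaleC scaleC' tau_add tau_scaleC closed_ops)
  moreover have "w \<in> A" using assms by (simp add: w_def closed_ops)
  ultimately show ?thesis
    using tau_square[of w] tau_square[of u] tau_square[of v] assms
    by (auto simp: ip_def complex_nonneg_Reals_iff)
qed

text \<open>Cauchy-Schwarz in arithmetic-geometric form, from the nonnegative square of c u - v. The
  free weight \<open>c\<close> will be the clipping weight of a node.\<close>

lemma ip_le:
  assumes u: "u \<in> A" and v: "v \<in> A" and c: "c > 0"
  shows "ip u v \<le> (c * ip u u + ip v v / c) / 2"
proof -
  have "0 \<le> ip (c *\<^sub>R u - v) (c *\<^sub>R u - v)"
    using u v by (intro ip_nonneg closed_ops)
  also have "\<dots> = c\<^sup>2 * ip u u - 2 * c * ip u v + ip v v"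
    using u v ip_commute[OF v u]
    by (simp add: ip_diff_left ip_diff_right ip_scaleR_left ip_scaleR_right closed_ops
        power2_eq_square algebra_simps)
  finally show ?thesis using c by (simp add: field_simps power2_eq_square)
qed

text \<open>If 1 - r |x|^2 is the square of a self-adjoint s, then the square norm of s d is that of
  d minus r times that of x d, and it is nonnegative.\<close>

lemma ip_compose_contraction:
  assumes x: "x \<in> A" "norm x \<le> 1" and d: "d \<in> A"
  shows "ip (x o\<^sub>L d) (x o\<^sub>L d) \<le> ip d d"
proof (rule field_le_mult_one_interval)
  \<comment> \<open>The factor r < 1 gives the strict bound \<open>norm T < 1\<close> that
    \<open>sqrt_exists\<close> asks for; letting r tend to 1 removes it.\<close>
  fix r :: real assume r: "0 < r" "r < 1"
  define T where "T = r *\<^sub>R (cadjoint x o\<^sub>L x)"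
  have T: "T \<in> A" "cadjoint T = T"
    using x by (simp_all add: T_def closed_ops cadjoint_scaleR cadjoint_compose cadjoint_cadjoint bop)
  have "norm (cadjoint x o\<^sub>L x) \<le> 1 * 1"
    using x norm_cadjoint_le[OF bop[OF x(1)]]
    by (intro order_trans[OF norm_blinfun_compose] mult_mono) auto
  then have "r * norm (cadjoint x o\<^sub>L x) \<le> r"
    using r by (intro mult_left_le) auto
  then have "norm T \<le> r" using r by (simp add: T_def)
  then have "norm T < 1" using r by simp
  then obtain s where s: "s \<in> A" "cadjoint s = s" "s o\<^sub>L s = id_blinfun - T"
    using sqrt_exists[OF T] by metis
  have "0 \<le> ip (s o\<^sub>L d) (s o\<^sub>L d)"
    using s d by (intro ip_nonneg closed_ops)
  also have "cadjoint (s o\<^sub>L d) o\<^sub>L (s o\<^sub>L d) = cadjoint d o\<^sub>L ((s o\<^sub>L s) o\<^sub>L d)"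
    using s(1,2) d by (simp add: cadjoint_compose bop blinfun_compose_assoc)
  then have "ip (s o\<^sub>L d) (s o\<^sub>L d) = ip d d - r * ip (x o\<^sub>L d) (x o\<^sub>L d)"
    using x d
    by (simp add: s(3) T_def ip_def cadjoint_compose bop blinfun_compose_assoc blinfun_compose_distrib
        blinfun_compose_scaleR tau_diff tau_scaleR closed_ops)
  finally show "r * ip (x o\<^sub>L d) (x o\<^sub>L d) \<le> ip d d" by simp
qed

lemma ip_self_le_1:
  assumes "x \<in> A" "norm x \<le> 1"
  shows "ip x x \<le> 1"
  using ip_compose_contraction[OF assms id_in] by (simp add: ip_def cadjoint_id tau_id)

end

section \<open>Positivity of the polynomial cone in |y|^2\<close>

context closed_star_algebra
begin

text \<open>Even powers of X are absorbed into the square, a remaining factor X is supplied by y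
  itself, and each factor 1 - X by the square root s of 1 - a, which commutes with a. This yields
  the positivity axiom of \<open>unit_interval_functional\<close>.\<close>

lemma op_poly_square_form:
  assumes y: "y \<in> A" and R: "R > (norm y)\<^sup>2"
  defines "a \<equiv> (1 / R) *\<^sub>R (cadjoint y o\<^sub>L y)"
  obtains d where "d \<in> A" "cadjoint d o\<^sub>L d = op_poly a ([:0, 1:] ^ i * [:1, -1:] ^ j * p\<^sup>2)"
proof -
  have R0: "R > 0" using R zero_le_power2[of "norm y"] by linarith
  have a: "a \<in> A" "cadjoint a = a"
    using y by (simp_all add: a_def closed_ops cadjoint_scaleR cadjoint_compose cadjoint_cadjoint bop)
  have "norm (cadjoint y o\<^sub>L y) \<le> norm y * norm y"
    using norm_cadjoint_le[OF bop[OF y]]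
    by (intro order_trans[OF norm_blinfun_compose] mult_right_mono) auto
  then have "norm a < 1"
    using R R0 by (simp add: a_def power2_eq_square)
  then obtain s where s: "s \<in> A" "cadjoint s = s" "s o\<^sub>L s = id_blinfun - a" "a o\<^sub>L s = s o\<^sub>L a"
    using sqrt_exists[OF a] by metis
  have square: "\<exists>d\<in>A. cadjoint d o\<^sub>L d = op_poly a (p\<^sup>2)" for p
    using a by (intro bexI[of _ "op_poly a p"])
      (simp_all add: cadjoint_op_poly op_poly_in power2_eq_square op_poly_mult)
  \<comment> \<open>No square root of a is required: y / sqrt R satisfies |y / sqrt R|^2 =
    a.\<close>
  have X_square: "\<exists>d\<in>A. cadjoint d o\<^sub>L d = op_poly a ([:0, 1:] * p\<^sup>2)" for p
  proof (intro bexI[of _ "(1 / sqrt R) *\<^sub>R (y o\<^sub>L op_poly a p)"])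
    let ?q = "op_poly a p"
    have q: "?q \<in> A" "cadjoint ?q = ?q" using a by (simp_all add: op_poly_in cadjoint_op_poly)
    have "cadjoint ((1 / sqrt R) *\<^sub>R (y o\<^sub>L ?q)) o\<^sub>L ((1 / sqrt R) *\<^sub>R (y o\<^sub>L ?q))
        = ?q o\<^sub>L (a o\<^sub>L ?q)"
      using y q R0 by (simp add: cadjoint_scaleR cadjoint_compose bop closed_ops blinfun_compose_scaleR
          blinfun_compose_assoc a_def)
    also have "\<dots> = a o\<^sub>L (?q o\<^sub>L ?q)"
      by (metis op_poly_commute blinfun_compose_assoc)
    finally show "cadjoint ((1 / sqrt R) *\<^sub>R (y o\<^sub>L ?q)) o\<^sub>L ((1 / sqrt R) *\<^sub>R (y o\<^sub>L ?q))
        = op_poly a ([:0, 1:] * p\<^sup>2)"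
      by (simp add: op_poly_mult power2_eq_square)
  qed (use y a in \<open>auto intro!: closed_ops op_poly_in\<close>)
  have "\<exists>d\<in>A. cadjoint d o\<^sub>L d = op_poly a ([:1, -1:] ^ j * ([:0, 1:] ^ i * p\<^sup>2))"
  proof (induction j)
    case 0
    show ?case
    proof (cases "even i")
      case True
      then have "[:0, 1:] ^ i * p\<^sup>2 = ([:0, 1:] ^ (i div 2) * p)\<^sup>2"
        by (simp add: power_mult_distrib power_mult[symmetric])
      then show ?thesis using square by simp
    next
      case False
      then have "[:0, 1:] ^ i = [:0, 1 :: real:] ^ (Suc (2 * (i div 2)))" by simp
      then have "[:0, 1:] ^ i * p\<^sup>2 = [:0, 1:] * ([:0, 1:] ^ (i div 2) * p)\<^sup>2"
        by (simp only: power_mult_distrib power_mult[symmetric] power_Suc mult_ac)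
      then show ?thesis using X_square by (simp only: power_0 mult_1_left)
    qed
  next
    case (Suc j)
    let ?p = "[:1, -1:] ^ j * ([:0, 1:] ^ i * p\<^sup>2)"
    from Suc obtain d where d: "d \<in> A" "cadjoint d o\<^sub>L d = op_poly a ?p" by blast
    \<comment> \<open>Multiplying the witness by s on the right contributes one more factor 1 - a,
      because s commutes with polynomials in a.\<close>
    have "cadjoint (d o\<^sub>L s) o\<^sub>L (d o\<^sub>L s) = s o\<^sub>L ((cadjoint d o\<^sub>L d) o\<^sub>L s)"
      using d(1) s by (simp add: cadjoint_compose bop blinfun_compose_assoc)
    also have "\<dots> = (s o\<^sub>L s) o\<^sub>L op_poly a ?p"
      unfolding d(2) op_poly_commute[OF s(4)] blinfun_compose_assoc ..
    also have "s o\<^sub>L s = op_poly a [:1, -1:]" 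
      using blinfun_compose_scaleR(2)[of a "-1" id_blinfun] by (simp add: s(3))
    also have "op_poly a [:1, -1:] o\<^sub>L op_poly a ?p = op_poly a ([:1, -1:] ^ Suc j * ([:0, 1:] ^ i * p\<^sup>2))"
      unfolding op_poly_mult[symmetric] power_Suc mult.assoc ..
    finally show ?case using d s by (blast intro: closed_ops)
  qed
  then show thesis using that by (auto simp: mult_ac)
qed

text \<open>Pulls a positive functional on the algebra back along polynomial evaluation; it is
  instantiated with vector states and with the trace.\<close>

lemma unit_interval_functionalI:
  assumes y: "y \<in> A" and R: "R > (norm y)\<^sup>2"
    and add: "\<And>u v. u \<in> A \<Longrightarrow> v \<in> A \<Longrightarrow> l (u + v) = l u + l v"
    and scale: "\<And>r u. u \<in> A \<Longrightarrow> l (r *\<^sub>R u) = r * l u"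
    and nonneg: "\<And>d. d \<in> A \<Longrightarrow> 0 \<le> l (cadjoint d o\<^sub>L d)"
  shows "unit_interval_functional (\<lambda>p. l (op_poly ((1 / R) *\<^sub>R (cadjoint y o\<^sub>L y)) p))"
proof
  fix p q :: "real poly" and c :: real and i j
  let ?a = "(1 / R) *\<^sub>R (cadjoint y o\<^sub>L y)"
  have a: "op_poly ?a p \<in> A" for p using y by (intro op_poly_in closed_ops)
  show "l (op_poly ?a (p + q)) = l (op_poly ?a p) + l (op_poly ?a q)"
    using a by (simp add: op_poly_add add)
  show "l (op_poly ?a (smult c p)) = c * l (op_poly ?a p)"
    using a by (simp add: op_poly_smult scale)
  obtain d where "d \<in> A" "cadjoint d o\<^sub>L d = op_poly ?a ([:0, 1:] ^ i * [:1, -1:] ^ j * p\<^sup>2)"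
    using op_poly_square_form[OF y R] by metis
  then show "0 \<le> l (op_poly ?a ([:0, 1:] ^ i * [:1, -1:] ^ j * p\<^sup>2))"
    using nonneg by metis
qed

end

subsection \<open>Clipping to the unit ball\<close>

text \<open>The added 1 makes |y|^2 / R a strict contraction and keeps R positive when y = 0. The
  value is a polynomial in y and its adjoint, so it stays in any unital star algebra containing y,
  closed or not. The degree parameter m^2 turns the Bernstein error into order 1/m.\<close>

definition clip :: "nat \<Rightarrow> ('h::chilbert_space \<Rightarrow>\<^sub>L 'h) \<Rightarrow> ('h \<Rightarrow>\<^sub>L 'h)"
  where "clip m y = (let R = (norm y)\<^sup>2 + 1 in
    y o\<^sub>L op_poly ((1 / R) *\<^sub>R (cadjoint y o\<^sub>L y)) (clip_poly R (m\<^sup>2)))"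

lemma (in unital_star_algebra) clip_in: "y \<in> A \<Longrightarrow> clip m y \<in> A"
  by (simp add: clip_def Let_def closed_ops op_poly_in)

text \<open>For a vector state, the squared norm of the clipped operator at the vector is R times
  the value at X b^2, which \<open>clip_poly_norm_bound\<close> controls.\<close>

lemma (in closed_star_algebra) norm_clip_le:
  assumes y: "y \<in> A" and m: "m > 0"
  shows "norm (clip m y) \<le> 1 + ((norm y)\<^sup>2 + 1) / m"
proof -
  define R where "R = (norm y)\<^sup>2 + 1"
  define a where "a = (1 / R) *\<^sub>R (cadjoint y o\<^sub>L y)"
  define b where "b = op_poly a (clip_poly R (m\<^sup>2))"
  have R: "R > (norm y)\<^sup>2" "R > 0" by (simp_all add: R_def add_nonneg_pos)
  have clip: "clip m y = y o\<^sub>L b" by (simp add: clip_def Let_def b_def a_def R_def)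
  have aA: "a \<in> A" "cadjoint a = a"
    using y by (simp_all add: a_def closed_ops cadjoint_scaleR cadjoint_compose cadjoint_cadjoint bop)
  have bA: "b \<in> A" "cadjoint b = b"
    using aA by (simp_all add: b_def op_poly_in cadjoint_op_poly)
  have "cadjoint (y o\<^sub>L b) o\<^sub>L (y o\<^sub>L b) = b o\<^sub>L ((R *\<^sub>R a) o\<^sub>L b)"
    using y bA R by (simp add: cadjoint_compose bop blinfun_compose_assoc a_def)
  also have "\<dots> = R *\<^sub>R (a o\<^sub>L (b o\<^sub>L b))"
    unfolding b_def by (metis op_poly_commute blinfun_compose_assoc blinfun_compose_scaleR)
  also have "\<dots> = R *\<^sub>R op_poly a ([:0, 1:] * (clip_poly R (m\<^sup>2))\<^sup>2)"
    by (simp add: b_def power2_eq_square op_poly_mult)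
  finally have sq: "cadjoint (y o\<^sub>L b) o\<^sub>L (y o\<^sub>L b) = \<dots>" .
  have "norm ((y o\<^sub>L b) \<xi>) \<le> (1 + R / m) * norm \<xi>" for \<xi>
  proof -
    interpret unit_interval_functional "\<lambda>p. Re (cinner (op_poly a p \<xi>) \<xi>)"
      unfolding a_def
    proof (rule unit_interval_functionalI[OF y R(1), where l = "\<lambda>T. Re (cinner (T \<xi>) \<xi>)"])
      show "0 \<le> Re (cinner ((cadjoint d o\<^sub>L d) \<xi>) \<xi>)" if "d \<in> A" for d
        unfolding cinner_cadjoint_compose_self[OF bop[OF that]] Re_complex_of_real by simp
    qed (simp_all add: blinfun.bilinear_simps cinner_add_left scaleR_scaleC cinner_scaleC_left)
    have "(norm ((y o\<^sub>L b) \<xi>))\<^sup>2 = Re (cinner ((cadjoint (y o\<^sub>L b) o\<^sub>L (y o\<^sub>L b)) \<xi>) \<xi>)"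
      using y bA by (subst cinner_cadjoint_compose_self) (simp_all add: bop closed_ops)
    also have "\<dots> = R * Re (cinner (op_poly a ([:0, 1:] * (clip_poly R (m\<^sup>2))\<^sup>2) \<xi>) \<xi>)"
      unfolding sq by (simp add: blinfun.bilinear_simps scaleR_scaleC cinner_scaleC_left)
    also have "\<dots> \<le> (1 + R / m) * Re (cinner (op_poly a 1 \<xi>) \<xi>)"
      by (rule clip_poly_norm_bound[OF m refl R(2)])
    also have "Re (cinner (op_poly a 1 \<xi>) \<xi>) = (norm \<xi>)\<^sup>2"
      unfolding op_poly_1 blinfun_apply_id_blinfun cinner_self Re_complex_of_real ..
    \<comment> \<open>Since 1 + R / m >= 1, passing to its square avoids a square root in the final
      bound.\<close>
    also have "(1 + R / m) * (norm \<xi>)\<^sup>2 \<le> (1 + R / m)\<^sup>2 * (norm \<xi>)\<^sup>2"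
      using R by (intro mult_right_mono self_le_power) auto
    finally have "(norm ((y o\<^sub>L b) \<xi>))\<^sup>2 \<le> ((1 + R / m) * norm \<xi>)\<^sup>2"
      by (simp add: power_mult_distrib)
    then show ?thesis
      by (rule power2_le_imp_le) (use R in simp)
  qed
  then have "norm (y o\<^sub>L b) \<le> 1 + R / m"
    using R by (intro norm_blinfun_bound) auto
  then show ?thesis by (simp add: clip R_def)
qed

context tracial_algebra
begin

text \<open>With z the clipped y, \<open>key\<close> is an approximate form of the variational
  inequality <y - z, x - z> <= 0 characterising the nearest point of a convex set. Expanding the
  square norm of x - y around z then gives the estimate.\<close>

lemma ip_clip_le:
  assumes y: "y \<in> A" and x: "x \<in> A" "norm x \<le> 1" and m: "m > 0"
  shows "ip (x - clip m y) (x - clip m y) \<le> ip (x - y) (x - y) + ((norm y)\<^sup>2 + 1) / m"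
proof -
  define R where "R = (norm y)\<^sup>2 + 1"
  define a where "a = (1 / R) *\<^sub>R (cadjoint y o\<^sub>L y)"
  define n where "n = m\<^sup>2"
  define z where "z = clip m y"
  let ?f = "clip_weight R n"
  have R: "R > (norm y)\<^sup>2" "R > 0" by (simp_all add: R_def add_nonneg_pos)
  have aA: "a \<in> A" "cadjoint a = a"
    using y by (simp_all add: a_def closed_ops cadjoint_scaleR cadjoint_compose cadjoint_cadjoint bop)
  note op_aA = op_poly_in[OF aA(1)] and op_a_adj = cadjoint_op_poly[OF aA]
  have yy: "cadjoint y o\<^sub>L y = R *\<^sub>R a" using R by (simp add: a_def)
  have z: "z = y o\<^sub>L op_poly a (clip_poly R n)"
    by (simp add: z_def clip_def Let_def a_def R_def n_def)
  have zA: "z \<in> A" using y by (simp add: z_def clip_in)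
  have op_diff: "op_poly a (p - q) = op_poly a p - op_poly a q" for p q
    using op_poly_add[of a "p - q" q] by (simp add: algebra_simps)
  have yz: "y - z = y o\<^sub>L op_poly a (1 - clip_poly R n)"
    by (simp add: z op_diff blinfun_compose_distrib)
  interpret unit_interval_functional "\<lambda>p. Re (\<tau> (op_poly a p))"
    unfolding a_def
  proof (rule unit_interval_functionalI[OF y R(1), where l = "\<lambda>T. Re (\<tau> T)"])
    show "0 \<le> Re (\<tau> (cadjoint d o\<^sub>L d))" if "d \<in> A" for d
      using tau_square[OF that] by (simp add: complex_nonneg_Reals_iff)
  qed (simp_all add: tau_add tau_scaleR)
  have poly_form: "ip (y o\<^sub>L op_poly a p) (y o\<^sub>L op_poly a q) = R * Re (\<tau> (op_poly a ([:0, 1:] * (p * q))))" for p q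
  proof -
    have "cadjoint (y o\<^sub>L op_poly a p) o\<^sub>L (y o\<^sub>L op_poly a q)
        = op_poly a p o\<^sub>L ((cadjoint y o\<^sub>L y) o\<^sub>L op_poly a q)"
      using y by (simp add: cadjoint_compose bop op_aA op_a_adj blinfun_compose_assoc)
    also have "\<dots> = R *\<^sub>R (op_poly a p o\<^sub>L (a o\<^sub>L op_poly a q))"
      by (simp add: yy blinfun_compose_scaleR)
    also have "\<dots> = R *\<^sub>R op_poly a ([:0, 1:] * (p * q))"
      by (simp add: op_poly_mult) (metis op_poly_commute blinfun_compose_assoc)
    finally show ?thesis
      by (simp only: ip_def tau_scaleR op_aA) simp
  qed
  have bern: "ip (y o\<^sub>L op_poly a (bern n k)) x
      \<le> (?f k * (R * Re (\<tau> (op_poly a ([:0, 1:] * bern n k)))) + Re (\<tau> (op_poly a (bern n k))) / ?f k) / 2" for k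
  proof -
    \<comment> \<open>The binomial coefficient becomes the square of a constant polynomial, so
      \<open>op_poly_square_form\<close> applies.\<close>
    have "bern n k = [:0, 1:] ^ k * [:1, -1:] ^ (n - k) * [:sqrt (n choose k):]\<^sup>2"
      by (simp add: bern_def power2_eq_square)
    then obtain d where d: "d \<in> A" and dd: "cadjoint d o\<^sub>L d = op_poly a (bern n k)"
      using op_poly_square_form[OF y R(1)] unfolding a_def by metis
    \<comment> \<open>The trace property moves one factor of the Bernstein term to the other side,
      which turns the inner product into one between y e and x e; there the contraction x can be
      discarded.\<close>
    let ?e = "cadjoint d"
    have eA: "?e \<in> A" and ee: "cadjoint ?e = d"
      using d by (simp_all add: closed_ops cadjoint_cadjoint bop)
    have "cadjoint (y o\<^sub>L op_poly a (bern n k)) o\<^sub>L x = op_poly a (bern n k) o\<^sub>L (cadjoint y o\<^sub>L x)"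
      using y by (simp add: cadjoint_compose bop op_aA op_a_adj blinfun_compose_assoc)
    then have "cadjoint (y o\<^sub>L op_poly a (bern n k)) o\<^sub>L x = ?e o\<^sub>L (d o\<^sub>L (cadjoint y o\<^sub>L x))"
      by (simp only: dd[symmetric] blinfun_compose_assoc)
    then have "ip (y o\<^sub>L op_poly a (bern n k)) x = Re (\<tau> ((d o\<^sub>L (cadjoint y o\<^sub>L x)) o\<^sub>L ?e))"
      using tau_commute[of ?e "d o\<^sub>L (cadjoint y o\<^sub>L x)"] x y d by (simp add: ip_def closed_ops)
    also have "\<dots> = ip (y o\<^sub>L ?e) (x o\<^sub>L ?e)"
      using y x d eA ee by (simp add: ip_def cadjoint_compose bop blinfun_compose_assoc)
    also have "\<dots> \<le> (?f k * ip (y o\<^sub>L ?e) (y o\<^sub>L ?e) + ip (x o\<^sub>L ?e) (x o\<^sub>L ?e) / ?f k) / 2"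
      using x y eA by (intro ip_le compose_in clip_weight_bounds)
    also have "\<dots> \<le> (?f k * ip (y o\<^sub>L ?e) (y o\<^sub>L ?e) + ip ?e ?e / ?f k) / 2"
      using ip_compose_contraction[OF x eA] clip_weight_bounds(1)[of R n k]
      by (intro divide_right_mono add_left_mono) auto
    also have "ip ?e ?e = Re (\<tau> (op_poly a (bern n k)))"
      unfolding ip_def ee dd[symmetric] using tau_commute[OF d eA] by simp
    also have "ip (y o\<^sub>L ?e) (y o\<^sub>L ?e) = Re (\<tau> (d o\<^sub>L ((cadjoint y o\<^sub>L y) o\<^sub>L ?e)))"
      using y eA ee by (simp add: ip_def cadjoint_compose bop blinfun_compose_assoc)
    also have "\<tau> (d o\<^sub>L ((cadjoint y o\<^sub>L y) o\<^sub>L ?e)) = \<tau> ((cadjoint y o\<^sub>L y) o\<^sub>L (?e o\<^sub>L d))"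
      using y d eA by (subst tau_commute) (simp_all add: closed_ops blinfun_compose_assoc)
    also have "(cadjoint y o\<^sub>L y) o\<^sub>L (?e o\<^sub>L d) = R *\<^sub>R op_poly a ([:0, 1:] * bern n k)"
      unfolding dd yy op_poly_mult by (simp add: blinfun_compose_scaleR)
    also have "Re (\<tau> (R *\<^sub>R op_poly a ([:0, 1:] * bern n k))) = R * Re (\<tau> (op_poly a ([:0, 1:] * bern n k)))"
      by (simp only: tau_scaleR op_aA) simp
    finally show ?thesis .
  qed
  have ip_sum: "ip (\<Sum>k\<in>K. g k) x = (\<Sum>k\<in>K. ip (g k) x) \<and> (\<Sum>k\<in>K. g k) \<in> A"
    if "\<And>k. g k \<in> A" for g and K :: "nat set"
  proof (induction K rule: infinite_finite_induct)
    case (insert k K)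
    then show ?case using that x by (simp add: ip_add_left closed_ops)
  qed (use ip_diff_left[of x x x] x in \<open>simp_all add: closed_ops\<close>)
  have op_sum: "op_poly a (\<Sum>k\<in>K. g k) = (\<Sum>k\<in>K. op_poly a (g k))" for g and K :: "nat set"
    by (induction K rule: infinite_finite_induct) (simp_all add: op_poly_add)
  \<comment> \<open>As the Bernstein polynomials sum to 1, y - z splits into Bernstein pieces of y
    with nonnegative weights 1 - f(k/n).\<close>
  have "1 - clip_poly R n = (\<Sum>k\<le>n. smult (1 - ?f k) (bern n k))"
    unfolding sum_bern[of n, symmetric] clip_poly_def sum_subtractf[symmetric] smult_diff_left by simp
  then have "y - z = (\<Sum>k\<le>n. (1 - ?f k) *\<^sub>R (y o\<^sub>L op_poly a (bern n k)))"
    by (simp add: yz op_sum op_poly_smult blinfun_compose_scaleR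
        bounded_bilinear.sum_right[OF bounded_bilinear_blinfun_compose])
  then have "ip (y - z) x = (\<Sum>k\<le>n. (1 - ?f k) * ip (y o\<^sub>L op_poly a (bern n k)) x)"
    using ip_sum[of "\<lambda>k. (1 - ?f k) *\<^sub>R (y o\<^sub>L op_poly a (bern n k))" "{..n}"] y x
    by (simp add: ip_scaleR_left closed_ops op_aA)
  also have "\<dots> \<le> R * Re (\<tau> (op_poly a ([:0, 1:] * ((1 - clip_poly R n) * clip_poly R n))))
      + R / (2 * m) * Re (\<tau> (op_poly a 1))"
    by (rule clip_poly_distance_bound[OF m n_def R(2) bern])
  also have "\<dots> = ip (y - z) z + R / (2 * m)"
    unfolding poly_form[symmetric] yz[symmetric] z[symmetric] by (simp add: tau_id)
  finally have key: "ip (y - z) (x - z) \<le> R / (2 * m)"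
    using x y zA by (simp add: ip_diff_right closed_ops)
  have "ip (x - y) (x - y) = ip ((x - z) - (y - z)) ((x - z) - (y - z))" by simp
  also have "\<dots> = ip (x - z) (x - z) - 2 * ip (y - z) (x - z) + ip (y - z) (y - z)"
    using x y zA ip_commute[of "x - z" "y - z"]
    by (simp only: ip_diff_left[of "x - z" "y - z"] ip_diff_right[of "x - z" "y - z"] closed_ops)
  finally have "ip (x - z) (x - z) \<le> ip (x - y) (x - y) + 2 * ip (y - z) (x - z)"
    using ip_nonneg[of "y - z"] y zA by (simp add: closed_ops)
  also have "\<dots> \<le> ip (x - y) (x - y) + R / m"
    using key by simp
  finally show ?thesis by (simp add: z_def R_def)
qed

text \<open>The clipped element has norm at most \<open>1 + O(1/m)\<close> only; rescaling brings it into the unit ball.\<close>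

lemma unit_ball_approximation:
  assumes B: "unital_star_algebra B" "B \<subseteq> A" and x: "x \<in> unit_ball A" and y: "y \<in> B"
    and less: "tau_norm \<tau> (x - y) < \<gamma>"
  shows "\<exists>w\<in>unit_ball B. tau_norm \<tau> (x - w) < \<gamma>"
proof -
  interpret B: unital_star_algebra B by (rule B)
  define R where "R = (norm y)\<^sup>2 + 1"
  define g where "g = ip (x - y) (x - y)"
  have xA: "x \<in> A" "norm x \<le> 1" and yA: "y \<in> A" using x y B(2) by (auto simp: unit_ball_def)
  have R0: "R > 0" by (simp add: R_def add_nonneg_pos)
  have g0: "0 \<le> g" using xA yA by (auto simp: g_def intro!: ip_nonneg closed_ops)
  have \<gamma>0: "\<gamma> > 0" using less g0 by (simp add: tau_norm_eq g_def[symmetric]) (meson less_le_trans not_le real_sqrt_ge_zero)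
  have "g < \<gamma>\<^sup>2"
    using less \<gamma>0 g0 power_strict_mono[of "sqrt g" \<gamma> 2] by (simp add: tau_norm_eq g_def[symmetric])
  \<comment> \<open>This expression is the bound obtained below for the square norm of x - w, with e
    = R / m; it tends to g.\<close>
  have "((\<lambda>m. (1 + R / real m) * (g + R / real m) + (R / real m + (R / real m)\<^sup>2)) \<longlongrightarrow> (1 + 0) * (g + 0) + (0 + 0\<^sup>2)) sequentially"
    by (intro tendsto_intros lim_const_over_n)
  then have "eventually (\<lambda>m. (1 + R / real m) * (g + R / real m) + (R / real m + (R / real m)\<^sup>2) < \<gamma>\<^sup>2) sequentially"
    using \<open>g < \<gamma>\<^sup>2\<close> by (intro order_tendstoD(2)) auto
  then have "eventually (\<lambda>m. m > 0 \<and> (1 + R / real m) * (g + R / real m) + (R / real m + (R / real m)\<^sup>2) < \<gamma>\<^sup>2) sequentially"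
    using eventually_gt_at_top[of 0] by eventually_elim simp
  then obtain m where m: "m > 0"
    and bd: "(1 + R / real m) * (g + R / real m) + (R / real m + (R / real m)\<^sup>2) < \<gamma>\<^sup>2"
    by (auto simp: eventually_sequentially)
  define e where "e = R / real m"
  have e0: "e > 0" using R0 m by (simp add: e_def)
  define z where "z = clip m y"
  define w where "w = (1 / (1 + e)) *\<^sub>R z"
  \<comment> \<open>Membership is taken in \<open>B\<close>, which need not be closed, while the
    norm and distance bounds are taken in the closed algebra \<open>A\<close>.\<close>
  have zB: "z \<in> B" using y by (simp add: z_def B.clip_in)
  then have zA: "z \<in> A" using B(2) by auto
  have wB: "w \<in> B" using zB by (simp add: w_def B.scaleR_in)
  then have wA: "w \<in> A" using B(2) by auto
  have "norm z \<le> 1 + e" using norm_clip_le[OF yA m] by (simp add: z_def e_def R_def)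
  then have nw: "norm w \<le> 1" using e0 by (simp add: w_def)
  have zw: "x - w = (x - z) + e *\<^sub>R w"
  proof -
    have "(1 + e) *\<^sub>R w = z" using e0 by (simp add: w_def)
    then show ?thesis by (simp add: algebra_simps)
  qed
  have "ip (x - w) (x - w) = ip (x - z) (x - z) + 2 * (e * ip (x - z) w) + e\<^sup>2 * ip w w"
    unfolding zw using xA(1) zA wA ip_commute[of w "x - z"]
    by (simp only: ip_add_left ip_add_right ip_scaleR_left ip_scaleR_right closed_ops)
      (simp add: power2_eq_square algebra_simps)
  also have "\<dots> \<le> ip (x - z) (x - z) + 2 * (e * ((1 * ip (x - z) (x - z) + ip w w / 1) / 2)) + e\<^sup>2 * ip w w"
    using e0 xA zA wA by (intro add_mono mult_left_mono ip_le closed_ops) auto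
  also have "\<dots> = (1 + e) * ip (x - z) (x - z) + (e + e\<^sup>2) * ip w w"
    by (simp add: algebra_simps)
  also have "\<dots> \<le> (1 + e) * (g + e) + (e + e\<^sup>2) * 1"
    using ip_clip_le[OF yA xA m] ip_self_le_1[OF wA nw] e0
    by (intro add_mono mult_left_mono) (auto simp: z_def g_def e_def R_def)
  also have "\<dots> < \<gamma>\<^sup>2" using bd by (simp add: e_def)
  finally have "sqrt (ip (x - w) (x - w)) < \<gamma>"
    using \<gamma>0 real_less_lsqrt[of \<gamma> "ip (x - w) (x - w)"] ip_nonneg[of "x - w"] xA wA by (simp add: closed_ops)
  then show ?thesis using wB nw by (intro bexI[of _ w]) (auto simp: tau_norm_eq unit_ball_def)
qed

end

subsection \<open>The two distances\<close>

text \<open>The substantial direction: an approximant in Q is moved into the unit ball. The slack e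
  turns the weak bound into the strict one that the approximation requires.\<close>

lemma near_contained_imp_Inf_le:
  assumes tr: "tracial_algebra M \<tau>" and P: "P \<subseteq> M"
    and Q: "unital_star_algebra Q" "Q \<subseteq> M" and near: "near_contained \<tau> \<gamma> P Q" and x: "x \<in> unit_ball P"
  shows "(INF y\<in>unit_ball Q. tau_norm \<tau> (x - y)) \<le> \<gamma>"
proof (rule field_le_epsilon)
  interpret tracial_algebra M \<tau> by (rule tr)
  fix e :: real assume "e > 0"
  obtain y where "y \<in> Q" "tau_norm \<tau> (x - y) \<le> \<gamma>"
    using near x by (auto simp: near_contained_def)
  moreover have "x \<in> unit_ball M" using x P by (auto simp: unit_ball_def)
  ultimately obtain w where w: "w \<in> unit_ball Q" "tau_norm \<tau> (x - w) < \<gamma> + e"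
    using unit_ball_approximation[OF Q, of x y "\<gamma> + e"] \<open>e > 0\<close> by auto
  have "bdd_below ((\<lambda>y. tau_norm \<tau> (x - y)) ` unit_ball Q)"
    using x P Q(2) by (intro bdd_belowI2[where m = 0])
      (auto simp: tau_norm_eq unit_ball_def intro!: ip_nonneg closed_ops)
  from cINF_lower2[OF this w(1)] show "(INF y\<in>unit_ball Q. tau_norm \<tau> (x - y)) \<le> \<gamma> + e"
    using w(2) by simp
qed

text \<open>The easy direction, since the unit ball of Q lies in Q. The strict hypothesis yields an
  actual approximant even when the infimum is not attained.\<close>

lemma Sup_Inf_less_imp_near_contained:
  assumes tr: "tracial_algebra M \<tau>" and P: "P \<subseteq> M" "0 \<in> P" and Q: "Q \<subseteq> M" "0 \<in> Q"
  shows Sup_Inf_nonneg: "0 \<le> (SUP x\<in>unit_ball P. INF y\<in>unit_ball Q. tau_norm \<tau> (x - y))"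
    and "(SUP x\<in>unit_ball P. INF y\<in>unit_ball Q. tau_norm \<tau> (x - y)) < \<gamma> \<Longrightarrow> near_contained \<tau> \<gamma> P Q"
proof -
  interpret tracial_algebra M \<tau> by (rule tr)
  let ?I = "\<lambda>x. INF y\<in>unit_ball Q. tau_norm \<tau> (x - y)"
  have P0: "0 \<in> unit_ball P" and Q0: "0 \<in> unit_ball Q" using P Q by (auto simp: unit_ball_def)
  have nonneg: "0 \<le> tau_norm \<tau> (x - y)" if "x \<in> unit_ball P" "y \<in> unit_ball Q" for x y
    using that P Q by (auto simp: tau_norm_eq unit_ball_def intro!: ip_nonneg closed_ops)
  have I0: "0 \<le> ?I x" if "x \<in> unit_ball P" for x
    using that Q0 by (intro cINF_greatest nonneg) auto
  \<comment> \<open>The candidate y = 0 bounds every infimum by 1, so the supremum is over a set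
    bounded above.\<close>
  have I1: "?I x \<le> 1" if x: "x \<in> unit_ball P" for x
  proof -
    have "bdd_below ((\<lambda>y. tau_norm \<tau> (x - y)) ` unit_ball Q)"
      using nonneg[OF x] by (intro bdd_belowI2[where m = 0])
    from cINF_lower[OF this Q0] have "?I x \<le> tau_norm \<tau> x" by simp
    also have "\<dots> \<le> 1" using x P by (auto simp: tau_norm_eq unit_ball_def intro!: ip_self_le_1)
    finally show ?thesis .
  qed
  have le: "?I x \<le> (SUP x\<in>unit_ball P. ?I x)" if "x \<in> unit_ball P" for x
    using that I1 by (intro cSUP_upper bdd_aboveI2[where M = 1])
  show "0 \<le> (SUP x\<in>unit_ball P. ?I x)" using le[OF P0] I0[OF P0] by simp
  show "near_contained \<tau> \<gamma> P Q" if less: "(SUP x\<in>unit_ball P. ?I x) < \<gamma>"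
    unfolding near_contained_def
  proof
    fix x assume x: "x \<in> unit_ball P"
    then have "?I x < \<gamma>" using le less by fastforce
    then obtain y where "y \<in> unit_ball Q" "tau_norm \<tau> (x - y) < \<gamma>"
      using cInf_lessD[of "(\<lambda>y. tau_norm \<tau> (x - y)) ` unit_ball Q" \<gamma>] Q0 by blast
    then show "\<exists>y\<in>Q. tau_norm \<tau> (x - y) \<le> \<gamma>" by (auto simp: unit_ball_def intro!: less_imp_le)
  qed
qed

theorem proposition5p8:
  fixes M P Q :: "('h::chilbert_space \<Rightarrow>\<^sub>L 'h) set"
    and \<tau> :: "('h \<Rightarrow>\<^sub>L 'h) \<Rightarrow> complex"
  assumes "von_neumann_algebra M"
    and "state_on M \<tau>" and "tracial_on M \<tau>" and "faithful_on M \<tau>" and "normal_on M \<tau>"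
    and "star_subalgebra P" and "P \<subseteq> M" and "id_blinfun \<in> P"
    and "star_subalgebra Q" and "Q \<subseteq> M" and "id_blinfun \<in> Q"
  shows "christensen_dist \<tau> P Q = mashood_taylor_dist \<tau> P Q"
proof -
  have tr: "tracial_algebra M \<tau>"
    using assms by unfold_locales
      (auto simp: von_neumann_algebra_def intro: closed_von_neumann_algebra)
  interpret tracial_algebra M \<tau> by (rule tr)
  have P: "unital_star_algebra P" and Q: "unital_star_algebra Q"
    using assms by (auto intro: unital_star_algebra.intro)
  have PQ0: "0 \<in> P" "0 \<in> Q" using P Q by (simp_all add: unital_star_algebra.zero_in)
  let ?h = "\<lambda>P Q. SUP x\<in>unit_ball P. INF y\<in>unit_ball Q. tau_norm \<tau> (x - y)"
  let ?S = "{\<gamma>. \<gamma> > 0 \<and> near_contained \<tau> \<gamma> P Q \<and> near_contained \<tau> \<gamma> Q P}"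
  \<comment> \<open>The second supremum in \<open>mashood_taylor_dist\<close> also uses x - y with x
    from P; symmetry brings it to the form of the first with P and Q exchanged.\<close>
  have sym: "tau_norm \<tau> (x - y) = tau_norm \<tau> (y - x)" if "x \<in> P" "y \<in> Q" for x y
  proof -
    have xy: "x \<in> M" "y \<in> M" using that assms by auto
    have "ip (x - y) (x - y) = ip ((-1) *\<^sub>R (y - x)) ((-1) *\<^sub>R (y - x))" by simp
    also have "\<dots> = ip (y - x) (y - x)"
      using xy by (simp only: ip_scaleR_left ip_scaleR_right closed_ops)
    finally show ?thesis by (simp add: tau_norm_eq)
  qed
  have "(SUP y\<in>unit_ball Q. INF x\<in>unit_ball P. tau_norm \<tau> (x - y)) = ?h Q P"
    by (intro SUP_cong INF_cong refl) (auto simp: unit_ball_def sym)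
  then have mt: "mashood_taylor_dist \<tau> P Q = max (?h P Q) (?h Q P)"
    by (simp add: mashood_taylor_dist_def)
  \<comment> \<open>Positivity of such a bound comes from \<open>Sup_Inf_nonneg\<close>.\<close>
  have mem: "\<gamma> \<in> ?S" if "max (?h P Q) (?h Q P) < \<gamma>" for \<gamma>
    using that Sup_Inf_nonneg[OF tr assms(7) PQ0(1) assms(10) PQ0(2)]
      Sup_Inf_less_imp_near_contained(2)[OF tr assms(7) PQ0(1) assms(10) PQ0(2)]
      Sup_Inf_less_imp_near_contained(2)[OF tr assms(10) PQ0(2) assms(7) PQ0(1)]
    by auto
  have ne: "unit_ball P \<noteq> {}" "unit_ball Q \<noteq> {}" using PQ0 by (auto simp: unit_ball_def intro!: exI[of _ 0])
  \<comment> \<open>Every number strictly above the maximum lies in the set, and every member of the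
    set dominates the maximum.\<close>
  have "Inf ?S = max (?h P Q) (?h Q P)"
  proof (rule antisym)
    show "Inf ?S \<le> max (?h P Q) (?h Q P)"
    proof (rule field_le_epsilon)
      fix e :: real assume "e > 0"
      then show "Inf ?S \<le> max (?h P Q) (?h Q P) + e"
        by (intro cInf_lower mem bdd_belowI[where m = 0]) auto
    qed
    have "?S \<noteq> {}" using mem[of "max (?h P Q) (?h Q P) + 1"] by auto
    then show "max (?h P Q) (?h Q P) \<le> Inf ?S"
    proof (rule cInf_greatest)
      fix \<gamma> assume \<gamma>: "\<gamma> \<in> ?S"
      show "max (?h P Q) (?h Q P) \<le> \<gamma>"
        using \<gamma> near_contained_imp_Inf_le[OF tr assms(7) Q assms(10)]
          near_contained_imp_Inf_le[OF tr assms(10) P assms(7)]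
        by (auto intro!: cSUP_least ne)
    qed
  qed
  then show ?thesis by (simp add: mt christensen_dist_def)
qed

end
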